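(* Let $E$ be a countable set, let $A:E\times E\to\{0,1\}$ be a finitely primitive incidence matrix and let $\psi:E_A^\infty\to\mathbb{R}$ be a normal potential such that $$\int_{E_A^\infty}|\psi|\,d\mu_\psi<+\infty.$$ Given $\xi\in E_A^\infty$ and a Borel set $B\subset E_A^\infty$ with $m_\psi(\partial B)=0$, let $$N^B_\xi(T):=\#\{\omega\in E^*_\xi:\ \omega\xi\in B\ \text{ and }\ S_{|\omega|}(-\psi)(\omega\xi)\le T\}.$$ Then $$\lim_{T\to\infty}\frac1T\int_0^T\frac{N^B_\xi(t)}{e^t}\,dt=\frac{\rho_\psi(\xi)}{\int_{E_A^\infty}(-\psi)\,d\mu_\psi}\cdot m_\psi(B).$$
   Context: $E$ is a finite or countably infinite alphabet; $E_A^\infty$ is the set of infinite words $\xi=\xi_0\xi_1\dots$ over $E$ with $A(\xi_i,\xi_{i+1})=1$ for all $i$ (admissible words), $E_A^*$ is the set of finite admissible words (including the empty word), $|\omega|$ is the length of $\omega$, $[\tau]$ is the cylinder of infinite admissible words beginning with $\tau$, and $\sigma$ is the left shift. $A$ is finitely primitive if there is a finite set $\Lambda\subset E_A^*$ of words of the same length such that for all $a,b\in E$ there is $\tau\in\Lambda$ with $a\tau b$ admissible. The metric is $d(\xi,\xi')=2^{-|\xi\wedge\xi'|}$, with $|\xi\wedge\xi'|$ the length of the common prefix. $C^\alpha(E_A^\infty)$ is the space of bounded functions with finite norm $\|f\|_\infty+v_\alpha(f)$, where $v_\alpha(f)=\sup_{\xi\ne\xi'}|f(\xi)-f(\xi')|/d(\xi,\xi')^\alpha$.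 $E^*_\xi$ is the set of $\omega\in E^*_A$ with $\omega\xi$ admissible, and $S_n\psi=\sum_{k=0}^{n-1}\psi\circ\sigma^k$. The transfer operator is $\mathcal{L}_\psi g(\omega)=\sum_{a\in E}e^{\psi(a\omega)}g(a\omega)$ (inadmissible terms are $0$). $\psi$ is summable if $\sum_{a\in E}\sup_{[a]}|e^\psi|<\infty$, and level 1 Hölder continuous with exponent $\alpha$ if $\sup_{a\in E}v_\alpha(\psi|_{[a]})<\infty$. For real summable level 1 Hölder $\psi$, $\mathcal{L}_\psi$ acts on $C^\alpha(E_A^\infty)$ with a simple maximal positive eigenvalue $\lambda_\psi$, the rest of the spectrum lying in a disk centered at $0$ of radius $<\lambda_\psi$; $m_\psi$ is the unique Borel probability measure with $\mathcal{L}_\psi^*m_\psi=\lambda_\psi m_\psi$; $\rho_\psi>0$ is the Hölder eigenfunction $\mathcal{L}_\psi\rho_\psi=\lambda_\psi\rho_\psi$ with $\int\rho_\psi\,dm_\psi=1$; $\mu_\psi=\rho_\psi m_\psi$; the pressure is $P(\psi)=\log\lambda_\psi$. A real potential $\psi$ is normal if it is level 1 Hölder continuous for some $\alpha>0$, summable, $\sup\psi<0$ and $P(\psi)=0$. *)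

theory Defs
  imports "HOL-Analysis.Analysis" "HOL-Probability.Probability_Measure" "HOL-Library.Stream"
begin

(* The alphabet is the countable type 'e; an incidence matrix with entries in {0,1} is a
   relation on it. Finite admissible words are the lists w with "successively A w"; the
   concatenation of a finite word w with an infinite word x is "w @- x". *)

definition shift_space :: "('e \<Rightarrow> 'e \<Rightarrow> bool) \<Rightarrow> 'e stream set" where
  "shift_space A = {\<xi>. \<forall>i. A (\<xi> !! i) (\<xi> !! Suc i)}"

definition finitely_primitive :: "('e \<Rightarrow> 'e \<Rightarrow> bool) \<Rightarrow> bool" where
  "finitely_primitive A \<longleftrightarrow>
     (\<exists>\<Lambda>. finite \<Lambda> \<and> \<Lambda> \<subseteq> {\<tau>. successively A \<tau>} \<and> (\<exists>k. \<forall>\<tau>\<in>\<Lambda>. length \<tau> = k) \<and>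
          (\<forall>a b. \<exists>\<tau>\<in>\<Lambda>. successively A (a # \<tau> @ [b])))"

definition cylinder :: "('e \<Rightarrow> 'e \<Rightarrow> bool) \<Rightarrow> 'e list \<Rightarrow> 'e stream set" where
  "cylinder A \<tau> = {\<xi> \<in> shift_space A. stake (length \<tau>) \<xi> = \<tau>}"

definition left_extensions :: "('e \<Rightarrow> 'e \<Rightarrow> bool) \<Rightarrow> 'e stream \<Rightarrow> 'e list set" where
  "left_extensions A \<xi> = {\<omega>. successively A \<omega> \<and> \<omega> @- \<xi> \<in> shift_space A}"

definition common_prefix_length :: "'e stream \<Rightarrow> 'e stream \<Rightarrow> nat" where
  "common_prefix_length \<xi> \<eta> = (LEAST i. \<xi> !! i \<noteq> \<eta> !! i)"

definition word_dist :: "'e stream \<Rightarrow> 'e stream \<Rightarrow> real" where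
  "word_dist \<xi> \<eta> = (if \<xi> = \<eta> then 0 else (1 / 2) ^ common_prefix_length \<xi> \<eta>)"

lemma word_dist_Metric_space: "Metric_space S word_dist"
proof
  fix x y z :: "'e stream"
  show "0 \<le> word_dist x y"
    by (simp add: word_dist_def)
  show "word_dist x y = word_dist y x"
    by (simp add: word_dist_def common_prefix_length_def eq_commute)
  show "word_dist x y = 0 \<longleftrightarrow> x = y"
    by (simp add: word_dist_def)
  show "word_dist x z \<le> word_dist x y + word_dist y z"
  proof (cases "x = z \<or> x = y \<or> y = z")
    case True
    then show ?thesis
      by (auto simp: word_dist_def)
  next
    case False
    let ?k = "common_prefix_length x z"
    have "\<exists>i. x !! i \<noteq> z !! i"
      using False by (metis smap_alt stream.map_id)
    then have "x !! ?k \<noteq> z !! ?k"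
      unfolding common_prefix_length_def by (rule LeastI_ex)
    then have "x !! ?k \<noteq> y !! ?k \<or> y !! ?k \<noteq> z !! ?k"
      by auto
    then have "common_prefix_length x y \<le> ?k \<or> common_prefix_length y z \<le> ?k"
      unfolding common_prefix_length_def[of x y] common_prefix_length_def[of y z]
      by (auto intro: Least_le)
    then have "(1 / 2) ^ ?k \<le> ((1 / 2) ^ common_prefix_length x y :: real) \<or>
               (1 / 2) ^ ?k \<le> ((1 / 2) ^ common_prefix_length y z :: real)"
      by (auto intro: power_decreasing)
    moreover have "0 \<le> ((1 / 2) ^ common_prefix_length x y :: real)"
      "0 \<le> ((1 / 2) ^ common_prefix_length y z :: real)"
      by auto
    ultimately show ?thesis
      using False unfolding word_dist_def by (smt (verit))
  qed
qed

definition word_topology :: "('e \<Rightarrow> 'e \<Rightarrow> bool) \<Rightarrow> 'e stream topology" where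
  "word_topology A = Metric_space.mtopology (shift_space A) word_dist"

definition word_borel :: "('e \<Rightarrow> 'e \<Rightarrow> bool) \<Rightarrow> 'e stream measure" where
  "word_borel A = sigma (shift_space A) {U. openin (word_topology A) U}"

definition holder_variation ::
  "real \<Rightarrow> 'e stream set \<Rightarrow> ('e stream \<Rightarrow> 'b::real_normed_vector) \<Rightarrow> ennreal" where
  "holder_variation \<alpha> S f =
     (SUP (\<xi>, \<eta>) \<in> {(\<xi>, \<eta>). \<xi> \<in> S \<and> \<eta> \<in> S \<and> \<xi> \<noteq> \<eta>}.
        ennreal (norm (f \<xi> - f \<eta>) / word_dist \<xi> \<eta> powr \<alpha>))"

(* A function on the shift space is represented by its extension by 0 to all streams, so that
   equality of elements of the space is equality of functions. *)
definition holder_space ::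
  "('e \<Rightarrow> 'e \<Rightarrow> bool) \<Rightarrow> real \<Rightarrow> ('e stream \<Rightarrow> 'b::real_normed_vector) set" where
  "holder_space A \<alpha> =
     {f. (\<forall>\<xi>. \<xi> \<notin> shift_space A \<longrightarrow> f \<xi> = 0) \<and> bounded (f ` shift_space A) \<and>
         holder_variation \<alpha> (shift_space A) f < \<infinity>}"

definition summable_potential ::
  "('e \<Rightarrow> 'e \<Rightarrow> bool) \<Rightarrow> ('e stream \<Rightarrow> real) \<Rightarrow> bool" where
  "summable_potential A \<psi> \<longleftrightarrow>
     (\<Sum>\<^sub>\<infinity>a\<in>UNIV. SUP \<xi>\<in>cylinder A [a]. ennreal \<bar>exp (\<psi> \<xi>)\<bar>) < \<infinity>"

definition level1_holder ::
  "('e \<Rightarrow> 'e \<Rightarrow> bool) \<Rightarrow> real \<Rightarrow> ('e stream \<Rightarrow> real) \<Rightarrow> bool" where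
  "level1_holder A \<alpha> \<psi> \<longleftrightarrow> (SUP a. holder_variation \<alpha> (cylinder A [a]) \<psi>) < \<infinity>"

(* Inadmissible terms are left out. In particular the value is 0 outside the shift space. *)
definition transfer_op ::
  "('e \<Rightarrow> 'e \<Rightarrow> bool) \<Rightarrow> ('e stream \<Rightarrow> real) \<Rightarrow>
   ('e stream \<Rightarrow> 'b::real_normed_vector) \<Rightarrow> 'e stream \<Rightarrow> 'b" where
  "transfer_op A \<psi> g \<omega> =
     (\<Sum>\<^sub>\<infinity>a\<in>{a. a ## \<omega> \<in> shift_space A}. exp (\<psi> (a ## \<omega>)) *\<^sub>R g (a ## \<omega>))"

definition shifted_op ::
  "('e \<Rightarrow> 'e \<Rightarrow> bool) \<Rightarrow> ('e stream \<Rightarrow> real) \<Rightarrow> complex \<Rightarrow>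
   ('e stream \<Rightarrow> complex) \<Rightarrow> 'e stream \<Rightarrow> complex" where
  "shifted_op A \<psi> z g \<omega> = z * g \<omega> - transfer_op A \<psi> g \<omega>"

(* By the bounded inverse theorem, bijectivity on the Banach space of Hoelder functions is
   invertibility as a bounded operator. *)
definition transfer_spectrum ::
  "('e \<Rightarrow> 'e \<Rightarrow> bool) \<Rightarrow> real \<Rightarrow> ('e stream \<Rightarrow> real) \<Rightarrow> complex set" where
  "transfer_spectrum A \<alpha> \<psi> =
     {z. \<not> bij_betw (shifted_op A \<psi> z) (holder_space A \<alpha>) (holder_space A \<alpha>)}"

(* Simple: some eigenvector spans the generalised eigenspace. *)
definition simple_eigenvalue ::
  "('e \<Rightarrow> 'e \<Rightarrow> bool) \<Rightarrow> real \<Rightarrow> ('e stream \<Rightarrow> real) \<Rightarrow> complex \<Rightarrow> bool" where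
  "simple_eigenvalue A \<alpha> \<psi> z \<longleftrightarrow>
     (\<exists>g\<in>holder_space A \<alpha>. g \<noteq> (\<lambda>\<omega>. 0) \<and> shifted_op A \<psi> z g = (\<lambda>\<omega>. 0) \<and>
        (\<forall>h\<in>holder_space A \<alpha>. \<forall>k. (shifted_op A \<psi> z ^^ k) h = (\<lambda>\<omega>. 0) \<longrightarrow>
           (\<exists>c. h = (\<lambda>\<omega>. c * g \<omega>))))"

definition maximal_eigenvalue ::
  "('e \<Rightarrow> 'e \<Rightarrow> bool) \<Rightarrow> real \<Rightarrow> ('e stream \<Rightarrow> real) \<Rightarrow> real \<Rightarrow> bool" where
  "maximal_eigenvalue A \<alpha> \<psi> l \<longleftrightarrow>
     0 < l \<and> simple_eigenvalue A \<alpha> \<psi> (complex_of_real l) \<and>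
     (\<exists>r<l. \<forall>z\<in>transfer_spectrum A \<alpha> \<psi> - {complex_of_real l}. cmod z \<le> r)"

(* For a summable level 1 Hoelder potential on a finitely primitive shift the eigenvalue exists for every
   exponent for which it is level 1 Hoelder, and does not depend on the exponent. *)
definition leading_eigenvalue ::
  "('e \<Rightarrow> 'e \<Rightarrow> bool) \<Rightarrow> ('e stream \<Rightarrow> real) \<Rightarrow> real" where
  "leading_eigenvalue A \<psi> =
     (THE l. \<exists>\<alpha>>0. level1_holder A \<alpha> \<psi> \<and> maximal_eigenvalue A \<alpha> \<psi> l)"

definition pressure :: "('e \<Rightarrow> 'e \<Rightarrow> bool) \<Rightarrow> ('e stream \<Rightarrow> real) \<Rightarrow> real" where
  "pressure A \<psi> = ln (leading_eigenvalue A \<psi>)"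

definition normal_potential ::
  "('e \<Rightarrow> 'e \<Rightarrow> bool) \<Rightarrow> ('e stream \<Rightarrow> real) \<Rightarrow> bool" where
  "normal_potential A \<psi> \<longleftrightarrow>
     (\<exists>\<alpha>>0. level1_holder A \<alpha> \<psi>) \<and> summable_potential A \<psi> \<and>
     (SUP \<xi>\<in>shift_space A. ereal (\<psi> \<xi>)) < 0 \<and> pressure A \<psi> = 0"

(* The dual operator is that of the action on bounded continuous functions. *)
definition eigenmeasure ::
  "('e \<Rightarrow> 'e \<Rightarrow> bool) \<Rightarrow> ('e stream \<Rightarrow> real) \<Rightarrow> 'e stream measure \<Rightarrow> bool" where
  "eigenmeasure A \<psi> m \<longleftrightarrow>
     prob_space m \<and> sets m = sets (word_borel A) \<and>
     (\<forall>g :: 'e stream \<Rightarrow> real.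
        continuous_map (word_topology A) euclidean g \<and> bounded (g ` shift_space A) \<longrightarrow>
        (\<integral>\<omega>. transfer_op A \<psi> g \<omega> \<partial>m) = leading_eigenvalue A \<psi> * (\<integral>\<omega>. g \<omega> \<partial>m))"

definition eigenfunction ::
  "('e \<Rightarrow> 'e \<Rightarrow> bool) \<Rightarrow> ('e stream \<Rightarrow> real) \<Rightarrow> 'e stream measure \<Rightarrow>
   ('e stream \<Rightarrow> real) \<Rightarrow> bool" where
  "eigenfunction A \<psi> m \<rho> \<longleftrightarrow>
     (\<exists>\<alpha>>0. \<rho> \<in> holder_space A \<alpha>) \<and>
     (\<forall>\<omega>\<in>shift_space A. 0 < \<rho> \<omega> \<and> transfer_op A \<psi> \<rho> \<omega> = leading_eigenvalue A \<psi> * \<rho> \<omega>) \<and>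
     (\<integral>\<omega>. \<rho> \<omega> \<partial>m) = 1"

definition equilibrium_state ::
  "'e stream measure \<Rightarrow> ('e stream \<Rightarrow> real) \<Rightarrow> 'e stream measure" where
  "equilibrium_state m \<rho> = density m (\<lambda>\<omega>. ennreal (\<rho> \<omega>))"

definition birkhoff_sum :: "nat \<Rightarrow> ('e stream \<Rightarrow> real) \<Rightarrow> 'e stream \<Rightarrow> real" where
  "birkhoff_sum n f \<xi> = (\<Sum>k<n. f (sdrop k \<xi>))"

(* For a normal potential the counted set is finite. *)
definition orbit_count ::
  "('e \<Rightarrow> 'e \<Rightarrow> bool) \<Rightarrow> ('e stream \<Rightarrow> real) \<Rightarrow> 'e stream \<Rightarrow> 'e stream set \<Rightarrow> real \<Rightarrow> nat" where
  "orbit_count A \<psi> \<xi> B T =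
     card {\<omega> \<in> left_extensions A \<xi>. \<omega> @- \<xi> \<in> B \<and>
             birkhoff_sum (length \<omega>) (\<lambda>\<eta>. - \<psi> \<eta>) (\<omega> @- \<xi>) \<le> T}"

end

theory Submission
  imports Defs "HOL-Probability.Stream_Space" "HOL-Real_Asymp.Real_Asymp"
begin

text \<open>
  The hypotheses say that the eigenvalue is \<open>\<lambda> = 1\<close>: it is positive, because the transfer operator maps
  the positive function \<open>\<rho>\<close> to \<open>\<lambda>\<rho>\<close>, and its logarithm vanishes. So \<open>\<rho>\<close> is harmonic for the transfer
  operator \<open>L\<close> and \<open>m\<close> is \<open>L\<close>-invariant. What remains is an elementary renewal theorem.

  For a set \<open>G\<close>, consider the mass of the backward orbit of a point \<open>x\<close> up to time \<open>T\<close>: the sum of \<open>e\<^sup>-\<^sup>S\<close>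
  over the words \<open>w\<close> with \<open>wx \<in> G\<close> and \<open>S \<le> T\<close>, where \<open>S\<close> is the Birkhoff sum of \<open>-\<psi>\<close> along \<open>w\<close> at \<open>wx\<close>. The
  integral of \<open>N(t) e\<^sup>-\<^sup>t\<close> over \<open>[0, T]\<close> is the sum of \<open>e\<^sup>-\<^sup>S - e\<^sup>-\<^sup>T\<close> over the counted words, which lies between
  the mass at time \<open>T - h\<close>, multiplied by \<open>1 - e\<^sup>-\<^sup>h\<close>, and the mass at time \<open>T\<close>; hence it suffices to
  find the limit of the mass divided by \<open>T\<close>.

  Splitting off the last letter of \<open>w\<close> gives the renewal equation. As each step advances \<open>S\<close> by
  at least a constant \<open>c > 0\<close>, because \<open>sup \<psi> < 0\<close>, a time window of length \<open>c\<close> is visited at most once along every backward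
  path, and harmonicity of \<open>\<rho>\<close> bounds the mass in a window uniformly in its position
  (\<open>window_sum_le_rho\<close>). Therefore \<open>mass T x / T\<close> is bounded and changes by \<open>O(1/T)\<close> when \<open>T\<close> is shifted by a
  constant. With bounded distortion, this makes the relative mass \<open>mass T x / (T \<rho> x)\<close> continuous
  in \<open>x\<close> in the limit when \<open>G\<close> is determined by finitely many letters.

  Let \<open>f\<close> be the relative mass. The renewal equation shows that \<open>\<rho>f\<close> is subharmonic for \<open>L\<close> up to \<open>1/T\<close>.
  Expanding the square and using the invariance of \<open>m\<close>, the energy \<open>\<integral>\<rho>(f - f \<circ> \<sigma>)\<^sup>2 dm\<close> is \<open>O(1/T)\<close>
  (\<open>dirichlet_form_le\<close>). The measure \<open>m\<close> charges every cylinder, so \<open>f - f \<circ> \<sigma>\<close> tends to \<open>0\<close> pointwise,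
  and finite primitivity spreads this to \<open>f y - f x \<rightarrow> 0\<close> for all \<open>x\<close> and \<open>y\<close>
  (\<open>rel_mass_asymptotically_constant\<close>).

  It remains to find the constant. Let \<open>Y\<^sub>T\<close> be the integral of the mass over the times up to \<open>T\<close>. Its
  renewal equation and the invariance of \<open>m\<close> give the exact identity
  \<open>\<integral>(Y\<^sub>T x - Y\<^bsub>T + \<psi> x\<^esub> x) dm = T m(G)\<close> (\<open>nn_integral_excursion\<close>), whose integrand is \<open>-\<psi> mass T\<close> up to
  an error that is bounded in \<open>T\<close> for each \<open>x\<close>. Dividing by \<open>T\<close> and using dominated convergence, where
  the integrability of \<open>\<psi>\<close> enters, the common limit of the relative mass times \<open>\<integral>-\<psi>\<rho> dm\<close> is \<open>m(G)\<close> (\<open>rel_mass_tendsto\<close>).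
  A Borel set \<open>B\<close> with null boundary is squeezed between the set of points whose cylinder of length
  \<open>k\<close> lies in \<open>B\<close> and the set of points whose cylinder meets \<open>B\<close>.
\<close>

section \<open>Cylinders, topology and Borel sets of the shift space\<close>

lemma stake_eq_iff: "stake k x = stake k y \<longleftrightarrow> (\<forall>i<k. x !! i = y !! i)"
  by (metis length_stake nth_equalityI stake_nth)

lemma stake_eq_mono: "stake k x = stake k y \<Longrightarrow> j \<le> k \<Longrightarrow> stake j x = stake j y"
  by (simp add: stake_eq_iff)

lemma word_dist_le_power:
  assumes "stake k x = stake k y"
  shows "word_dist x y \<le> (1 / 2) ^ k"
proof (cases "x = y")
  case False
  then have "\<exists>i. x !! i \<noteq> y !! i"
    by (metis smap_alt stream.map_id)
  then have "x !! common_prefix_length x y \<noteq> y !! common_prefix_length x y"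
    unfolding common_prefix_length_def by (rule LeastI_ex)
  then have "k \<le> common_prefix_length x y"
    using assms by (meson not_le stake_eq_iff)
  then show ?thesis
    using False by (simp add: word_dist_def power_decreasing)
qed (simp add: word_dist_def)

lemma stake_eq_if_word_dist_less:
  assumes "word_dist x y < (1 / 2) ^ k"
  shows "stake k x = stake k y"
proof (cases "x = y")
  case False
  then have "(1 / 2) ^ common_prefix_length x y < (1 / 2 :: real) ^ k"
    using assms by (simp add: word_dist_def)
  then have "k < common_prefix_length x y"
    by (simp add: power_strict_decreasing_iff)
  then show ?thesis
    unfolding stake_eq_iff common_prefix_length_def by (meson not_less_Least order.strict_trans)
qed simp

lemma topspace_word_topology [simp]: "topspace (word_topology A) = shift_space A"
  by (simp add: word_topology_def Metric_space.topspace_mtopology word_dist_Metric_space)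

lemma openin_word_topology:
  "openin (word_topology A) U \<longleftrightarrow>
    U \<subseteq> shift_space A \<and>
    (\<forall>x\<in>U. \<exists>k. \<forall>y\<in>shift_space A. stake k y = stake k x \<longrightarrow> y \<in> U)"
proof -
  interpret Metric_space "shift_space A" word_dist by (rule word_dist_Metric_space)
  have "(\<exists>r>0. mball x r \<subseteq> U) \<longleftrightarrow>
      (\<exists>k. \<forall>y\<in>shift_space A. stake k y = stake k x \<longrightarrow> y \<in> U)"
    if "x \<in> shift_space A" for x
  proof
    assume "\<exists>r>0. mball x r \<subseteq> U"
    then obtain r where r: "r > 0" "mball x r \<subseteq> U" by blast
    obtain k where "(1/2::real) ^ k < r"
      using real_arch_pow_inv[OF \<open>r > 0\<close>, of "1/2"] by auto
    then have "\<forall>y\<in>shift_space A. stake k y = stake k x \<longrightarrow> y \<in> U"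
      using r(2) that word_dist_le_power[of k x]
      by (smt (verit, best) in_mball subsetD)
    then show "\<exists>k. \<forall>y\<in>shift_space A. stake k y = stake k x \<longrightarrow> y \<in> U" ..
  next
    assume "\<exists>k. \<forall>y\<in>shift_space A. stake k y = stake k x \<longrightarrow> y \<in> U"
    then obtain k where k: "\<forall>y\<in>shift_space A. stake k y = stake k x \<longrightarrow> y \<in> U" ..
    then have "mball x ((1/2) ^ k) \<subseteq> U"
      using stake_eq_if_word_dist_less[of x _ k] by (auto simp: in_mball)
    then show "\<exists>r>0. mball x r \<subseteq> U"
      by (intro exI[of _ "(1/2) ^ k"]) auto
  qed
  then show ?thesis
    unfolding word_topology_def openin_mtopology by (meson subsetD)
qed

lemma continuous_map_if_locally_constant:
  fixes g :: "'e stream \<Rightarrow> real"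
  assumes "\<And>x y. stake k x = stake k y \<Longrightarrow> g x = g y"
  shows "continuous_map (word_topology A) euclidean g"
  unfolding continuous_map_def openin_word_topology topspace_word_topology
proof (intro conjI allI impI ballI)
  fix U x assume "x \<in> {x \<in> shift_space A. g x \<in> U}"
  then have "y \<in> {x \<in> shift_space A. g x \<in> U}" if "y \<in> shift_space A" "stake k y = stake k x" for y
    using that assms[OF that(2)] by simp
  then show "\<exists>k. \<forall>y\<in>shift_space A. stake k y = stake k x \<longrightarrow> y \<in> {x \<in> shift_space A. g x \<in> U}"
    by blast
qed auto

abbreviation words_measure :: "'e stream measure" where
  "words_measure \<equiv> stream_space (count_space UNIV)"

lemma shift_space_sets [measurable]:
  "shift_space A \<in> sets (words_measure :: 'e::countable stream measure)"
proof -
  have [measurable]: "Measurable.pred (words_measure :: 'e stream measure)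
      (\<lambda>\<xi>. A (\<xi> !! i) (\<xi> !! Suc i))" for i
    by measurable
  have "{\<xi> \<in> space (words_measure :: 'e stream measure). \<forall>i. A (\<xi> !! i) (\<xi> !! Suc i)}
      \<in> sets words_measure"
    by measurable
  then show ?thesis
    by (simp add: shift_space_def space_stream_space)
qed

lemma stake_in_sets [measurable]:
  "{\<eta>. stake k \<eta> \<in> W} \<in> sets (words_measure :: 'e::countable stream measure)"
proof -
  have "stake k -` W \<inter> space (words_measure :: 'e stream measure) \<in> sets words_measure"
    by (rule measurable_sets[OF measurable_stake]) simp
  also have "stake k -` W \<inter> space (words_measure :: 'e stream measure) = {\<eta>. stake k \<eta> \<in> W}"
    by (auto simp: space_stream_space)
  finally show ?thesis .
qed

text \<open>Measurability of prefixing and dropping letters is a matter of coordinates, hence the passage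
  from the metric Borel sets to the product \<open>\<sigma>\<close>-algebra of all streams. Open sets are countable unions of
  cylinders because the alphabet is countable.\<close>

lemma sets_word_borel:
  fixes A :: "'e::countable \<Rightarrow> 'e \<Rightarrow> bool"
  shows "sets (word_borel A) = sets (restrict_space words_measure (shift_space A))"
proof -
  let ?X = "shift_space A"
  have gen: "sets (word_borel A) = sigma_sets ?X {U. openin (word_topology A) U}"
    unfolding word_borel_def by (rule sets_measure_of) (auto simp: openin_word_topology)
  have space: "space (word_borel A) = ?X"
    unfolding word_borel_def by (rule space_measure_of) (auto simp: openin_word_topology)
  show ?thesis
  proof
    show "sets (word_borel A) \<subseteq> sets (restrict_space words_measure ?X)"
      unfolding gen
    proof (rule sets.sigma_sets_subset')
      show "?X \<in> sets (restrict_space words_measure ?X)"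
        by (auto simp: sets_restrict_space)
      show "{U. openin (word_topology A) U} \<subseteq> sets (restrict_space words_measure ?X)"
      proof safe
        fix U assume U: "openin (word_topology A) U"
        define W where "W k = {w. \<forall>y\<in>?X. stake k y = w \<longrightarrow> y \<in> U}" for k
        have "U = ?X \<inter> (\<Union>k. {\<eta>. stake k \<eta> \<in> W k})"
          using U unfolding openin_word_topology W_def by auto
        moreover have "(\<Union>k. {\<eta>. stake k \<eta> \<in> W k}) \<in> sets words_measure"
          by measurable
        ultimately show "U \<in> sets (restrict_space words_measure ?X)"
          by (auto simp: sets_restrict_space)
      qed
    qed
    have "(\<lambda>\<eta>. \<eta>) \<in> word_borel A \<rightarrow>\<^sub>M words_measure"
    proof (rule measurable_stream_space2, rule measurableI)
      fix n and V :: "'e set"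
      have "openin (word_topology A) {\<eta> \<in> ?X. \<eta> !! n \<in> V}"
        unfolding openin_word_topology
      proof (intro conjI ballI)
        fix x assume x: "x \<in> {\<eta> \<in> ?X. \<eta> !! n \<in> V}"
        have "y \<in> {\<eta> \<in> ?X. \<eta> !! n \<in> V}" if "y \<in> ?X" "stake (Suc n) y = stake (Suc n) x" for y
        proof -
          have "y !! n = x !! n"
            using that(2) unfolding stake_eq_iff by blast
          then show ?thesis using x that(1) by simp
        qed
        then show "\<exists>k. \<forall>y\<in>?X. stake k y = stake k x \<longrightarrow> y \<in> {\<eta> \<in> ?X. \<eta> !! n \<in> V}"
          by blast
      qed auto
      then have "{\<eta> \<in> ?X. \<eta> !! n \<in> V} \<in> sets (word_borel A)"
        unfolding gen by auto
      moreover have "(\<lambda>\<eta>. \<eta> !! n) -` V \<inter> space (word_borel A) = {\<eta> \<in> ?X. \<eta> !! n \<in> V}"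
        unfolding space by auto
      ultimately show "(\<lambda>\<eta>. \<eta> !! n) -` V \<inter> space (word_borel A) \<in> sets (word_borel A)"
        by simp
    qed simp
    then show "sets (restrict_space words_measure ?X) \<subseteq> sets (word_borel A)"
      unfolding sets_restrict_space
      by (auto simp: space dest!: measurable_sets simp: Int_commute vimage_def)
  qed
qed

text \<open>The preimage of an open set is a union of cylinders, and there are only countably many cylinders.\<close>

lemma borel_measurable_if_continuous:
  fixes f :: "'e::countable stream \<Rightarrow> real"
  assumes "\<And>x e. x \<in> shift_space A \<Longrightarrow> 0 < e \<Longrightarrow>
    \<exists>k. \<forall>y\<in>shift_space A. stake k y = stake k x \<longrightarrow> \<bar>f y - f x\<bar> < e"
  shows "f \<in> borel_measurable (restrict_space words_measure (shift_space A))"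
proof (rule borel_measurableI)
  fix U :: "real set" assume "open U"
  define W where "W k = {w. \<forall>y\<in>shift_space A. stake k y = w \<longrightarrow> f y \<in> U}" for k
  have "\<exists>k. stake k x \<in> W k" if x: "x \<in> shift_space A" "f x \<in> U" for x
  proof -
    obtain e where "e > 0" "\<And>z. \<bar>z - f x\<bar> < e \<Longrightarrow> z \<in> U"
      using \<open>open U\<close> x(2) unfolding open_dist dist_real_def by blast
    then show ?thesis
      using assms[OF x(1) \<open>e > 0\<close>] unfolding W_def by blast
  qed
  then have "f -` U \<inter> space (restrict_space words_measure (shift_space A))
      = shift_space A \<inter> (\<Union>k. {\<eta>. stake k \<eta> \<in> W k})"
    unfolding W_def by (auto simp: space_restrict_space space_stream_space)
  moreover have "(\<Union>k. {\<eta>. stake k \<eta> \<in> W k}) \<in> sets words_measure"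
    by measurable
  ultimately show "f -` U \<inter> space (restrict_space words_measure (shift_space A))
      \<in> sets (restrict_space words_measure (shift_space A))"
    by (auto simp: sets_restrict_space)
qed

lemma mem_shift_space_iff: "x \<in> shift_space A \<longleftrightarrow> (\<forall>i. A (x !! i) (x !! Suc i))"
  by (simp add: shift_space_def)

lemma sdrop_in_shift_space: "x \<in> shift_space A \<Longrightarrow> sdrop n x \<in> shift_space A"
  by (simp add: mem_shift_space_iff sdrop_snth del: snth.simps)

lemma shift_space_suffix: "w @- x \<in> shift_space A \<Longrightarrow> x \<in> shift_space A"
  using sdrop_in_shift_space[of "w @- x" A "length w"] by (simp add: sdrop_shift)

lemma Cons_in_shift_space:
  "a ## x \<in> shift_space A \<longleftrightarrow> A a (x !! 0) \<and> x \<in> shift_space A"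
  unfolding mem_shift_space_iff by (auto simp: Stream_snth split: nat.splits)

lemma shift_in_shift_space:
  "w @- x \<in> shift_space A \<longleftrightarrow> successively A (w @ [x !! 0]) \<and> x \<in> shift_space A"
proof (induction w)
  case (Cons a w)
  have "(w @- x) !! 0 = hd (w @ [x !! 0])"
    by (cases w) auto
  then show ?case
    using Cons by (auto simp: Cons_in_shift_space successively_Cons)
qed simp

lemma left_extensions_eq: "left_extensions A \<xi> = {w. w @- \<xi> \<in> shift_space A}"
  by (auto simp: left_extensions_def shift_in_shift_space successively_append_iff)

text \<open>Admissibility in front of a point depends on its first letter only, so nearby points have the same
  backward words. This allows sums over backward orbits to be compared term by term.\<close>

lemma shift_in_shift_space_cong:
  "x \<in> shift_space A \<Longrightarrow> y \<in> shift_space A \<Longrightarrow> stake k x = stake k y \<Longrightarrow> 0 < k \<Longrightarrow>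
    w @- x \<in> shift_space A \<longleftrightarrow> w @- y \<in> shift_space A"
  unfolding shift_in_shift_space stake_eq_iff by (metis (no_types))

text \<open>The form in which finite primitivity is used: any prefix can be placed before any point, at the
  price of one of finitely many connecting words.\<close>

lemma finitely_primitive_bridge:
  assumes "finitely_primitive A"
  obtains \<Lambda> where "finite \<Lambda>"
    and "\<And>x y k. x \<in> shift_space A \<Longrightarrow> y \<in> shift_space A \<Longrightarrow> 0 < k \<Longrightarrow>
      \<exists>\<tau>\<in>\<Lambda>. (stake k x @ \<tau>) @- y \<in> shift_space A"
proof -
  obtain \<Lambda> where fin: "finite \<Lambda>"
    and bridge: "\<And>a b. \<exists>\<tau>\<in>\<Lambda>. successively A (a # \<tau> @ [b])"
    using assms unfolding finitely_primitive_def by meson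
  show thesis
  proof (rule that[OF fin])
    fix x y :: "'a stream" and k :: nat
    assume x: "x \<in> shift_space A" and y: "y \<in> shift_space A" and "0 < k"
    then obtain j where k: "k = Suc j" by (cases k) auto
    obtain \<tau> where \<tau>: "\<tau> \<in> \<Lambda>" "successively A (x !! j # \<tau> @ [y !! 0])"
      using bridge by blast
    have "successively A (stake k x)"
      unfolding successively_conv_nth using x by (auto simp: mem_shift_space_iff simp del: snth.simps)
    then have "successively A ((stake k x @ \<tau>) @ [y !! 0])"
      using \<tau>(2) unfolding k stake_Suc
      by (auto simp: successively_append_iff successively_Cons)
    then have "(stake k x @ \<tau>) @- y \<in> shift_space A"
      using y unfolding shift_in_shift_space[of "stake k x @ \<tau>"] by simp
    then show "\<exists>\<tau>\<in>\<Lambda>. (stake k x @ \<tau>) @- y \<in> shift_space A"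
      using \<tau>(1) by blast
  qed
qed

lemma interior_of_word_topology:
  "word_topology A interior_of B =
    {x \<in> shift_space A. \<exists>k. \<forall>y\<in>shift_space A. stake k y = stake k x \<longrightarrow> y \<in> B}"
proof (intro set_eqI iffI)
  fix x assume "x \<in> word_topology A interior_of B"
  then obtain T where "openin (word_topology A) T" "x \<in> T" "T \<subseteq> B"
    unfolding interior_of_def by blast
  then show "x \<in> {x \<in> shift_space A. \<exists>k. \<forall>y\<in>shift_space A. stake k y = stake k x \<longrightarrow> y \<in> B}"
    unfolding openin_word_topology by blast
next
  fix x assume "x \<in> {x \<in> shift_space A. \<exists>k. \<forall>y\<in>shift_space A. stake k y = stake k x \<longrightarrow> y \<in> B}"
  then obtain k where x: "x \<in> shift_space A" "\<forall>y\<in>shift_space A. stake k y = stake k x \<longrightarrow> y \<in> B"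
    by blast
  have "openin (word_topology A) {y \<in> shift_space A. stake k y = stake k x}"
    unfolding openin_word_topology by (auto intro!: exI[of _ k])
  then show "x \<in> word_topology A interior_of B"
    unfolding interior_of_def using x by blast
qed

lemma closure_of_word_topology:
  "word_topology A closure_of B =
    {x \<in> shift_space A. \<forall>k. \<exists>y\<in>shift_space A \<inter> B. stake k y = stake k x}"
  unfolding closure_of_interior_of interior_of_word_topology topspace_word_topology by blast

text \<open>Together with \<open>Int_stable_cylinders\<close> this lets a finite measure be identified from its values on
  cylinders, the only sets on which the invariance under the dual operator is used directly.\<close>

lemma sets_word_borel_cylinders:
  fixes A :: "'e::countable \<Rightarrow> 'e \<Rightarrow> bool"
  shows "sets (word_borel A) =
    sigma_sets (shift_space A) (range (\<lambda>(k, w). {x \<in> shift_space A. stake k x = w}))"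
    (is "_ = sigma_sets ?X ?E")
proof -
  have gen: "sets (word_borel A) = sigma_sets ?X {U. openin (word_topology A) U}"
    unfolding word_borel_def by (rule sets_measure_of) (auto simp: openin_word_topology)
  have E_sub: "?E \<subseteq> Pow ?X" by auto
  show ?thesis
    unfolding gen
  proof (rule sigma_sets_eqI)
    fix U assume "U \<in> {U. openin (word_topology A) U}"
    then have U: "openin (word_topology A) U" by simp
    define W where "W = {(k, w). \<forall>y\<in>?X. stake k y = w \<longrightarrow> y \<in> U}"
    have "U = (\<Union>(k, w)\<in>W. {x \<in> ?X. stake k x = w})"
      using U unfolding openin_word_topology W_def by auto
    also have "\<dots> \<in> sigma_sets ?X ?E"
    proof -
      interpret sigma_algebra ?X "sigma_sets ?X ?E"
        by (rule sigma_algebra_sigma_sets[OF E_sub])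
      show ?thesis
        by (rule countable_UN') (auto intro!: sigma_sets.Basic)
    qed
    finally show "U \<in> sigma_sets ?X ?E" .
  next
    fix U assume "U \<in> ?E"
    then obtain k w where U: "U = {x \<in> ?X. stake k x = w}" by auto
    have "openin (word_topology A) U"
      unfolding openin_word_topology U by auto
    then show "U \<in> sigma_sets ?X {U. openin (word_topology A) U}" by auto
  qed
qed

lemma Int_stable_cylinders:
  "Int_stable (range (\<lambda>(k, w). {x \<in> shift_space A. stake k x = w}))"
proof (rule Int_stableI)
  fix a b assume "a \<in> range (\<lambda>(k, w). {x \<in> shift_space A. stake k x = w})"
    "b \<in> range (\<lambda>(k, w). {x \<in> shift_space A. stake k x = w})"
  then obtain k v l w where a: "a = {x \<in> shift_space A. stake k x = v}"
    and b: "b = {x \<in> shift_space A. stake l x = w}" by auto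
  have *: "{x \<in> shift_space A. stake k x = v} \<inter> {x \<in> shift_space A. stake l x = w} =
      (if take k w = v then {x \<in> shift_space A. stake l x = w} else {x \<in> shift_space A. stake 0 x = [undefined]})"
    if "k \<le> l" for k l v w
    using that by (auto simp: take_stake min_def)
  have cyl: "{x \<in> shift_space A. stake k x = w} \<in> range (\<lambda>(k, w). {x \<in> shift_space A. stake k x = w})"
    for k w
    by (rule image_eqI[of _ _ "(k, w)"]) auto
  show "a \<inter> b \<in> range (\<lambda>(k, w). {x \<in> shift_space A. stake k x = w})"
  proof (cases "k \<le> l")
    case True
    show ?thesis unfolding a b *[OF True] using cyl by presburger
  next
    case False
    then have "l \<le> k" by simp
    show ?thesis
      unfolding a b Int_commute[of "{x \<in> shift_space A. stake k x = v}"] *[OF \<open>l \<le> k\<close>]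
      using cyl by presburger
  qed
qed

section \<open>The transfer operator on nonnegative functions\<close>

text \<open>Words are split at their last letter because it is the one next to the base point of a
  backward orbit.\<close>

lemma nn_integral_count_space_snoc:
  fixes f :: "'a list \<Rightarrow> ennreal"
  shows "(\<integral>\<^sup>+w. f w \<partial>count_space UNIV) =
    f [] + (\<integral>\<^sup>+a. \<integral>\<^sup>+w. f (w @ [a]) \<partial>count_space UNIV \<partial>count_space UNIV)"
proof -
  have "bij_betw (\<lambda>(a::'a, w). w @ [a]) UNIV (- {[]})"
    by (intro bij_betwI[where g = "\<lambda>w. (last w, butlast w)"]) auto
  then have "(\<integral>\<^sup>+w. f w \<partial>count_space (- {[]})) =
      (\<integral>\<^sup>+p. f (case p of (a, w) \<Rightarrow> w @ [a]) \<partial>count_space UNIV)"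
    by (rule nn_integral_bij_count_space[symmetric])
  also have "\<dots> = (\<integral>\<^sup>+a. \<integral>\<^sup>+w. f (w @ [a]) \<partial>count_space UNIV \<partial>count_space UNIV)"
    by (subst nn_integral_fst_count_space[symmetric]) simp
  finally have tail: "(\<integral>\<^sup>+w. f w * indicator (- {[]}) w \<partial>count_space UNIV) =
      (\<integral>\<^sup>+a. \<integral>\<^sup>+w. f (w @ [a]) \<partial>count_space UNIV \<partial>count_space UNIV)"
    by (subst (asm) nn_integral_count_space_indicator) auto
  have "(\<integral>\<^sup>+w. f w \<partial>count_space UNIV) =
      (\<integral>\<^sup>+w. f w * indicator {[]} w + f w * indicator (- {[]}) w \<partial>count_space UNIV)"
    by (intro nn_integral_cong) (auto simp: indicator_def)
  also have "\<dots> = f [] + (\<integral>\<^sup>+w. f w * indicator (- {[]}) w \<partial>count_space UNIV)"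
    by (subst nn_integral_add) (auto simp: nn_integral_indicator_singleton)
  finally show ?thesis unfolding tail .
qed

lemma borel_measurable_nn_integral_count_space:
  fixes F :: "'i::countable \<Rightarrow> 'a \<Rightarrow> ennreal"
  assumes "\<And>i. F i \<in> borel_measurable M"
  shows "(\<lambda>x. \<integral>\<^sup>+i. F i x \<partial>count_space UNIV) \<in> borel_measurable M"
proof -
  interpret sigma_finite_measure "count_space (UNIV :: 'i set)"
    by (rule sigma_finite_measure_count_space)
  have "(\<lambda>(i, x). F i x) \<in> borel_measurable (count_space UNIV \<Otimes>\<^sub>M M)"
    using assms by (intro measurable_pair_measure_countable1) auto
  then have "(\<lambda>(x, i). F i x) \<in> borel_measurable (M \<Otimes>\<^sub>M count_space UNIV)"
    by (subst measurable_pair_swap_iff) (simp add: case_prod_beta')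
  then show ?thesis
    by (rule borel_measurable_nn_integral)
qed

text \<open>The transfer operator with values in the extended nonnegative reals, where sums over an infinite
  alphabet need no convergence arguments.\<close>

definition nn_transfer ::
  "('e \<Rightarrow> 'e \<Rightarrow> bool) \<Rightarrow> ('e stream \<Rightarrow> real) \<Rightarrow> ('e stream \<Rightarrow> ennreal) \<Rightarrow> 'e stream \<Rightarrow> ennreal" where
  "nn_transfer A \<psi> f \<eta> =
    (\<integral>\<^sup>+a. indicator (shift_space A) (a ## \<eta>) * ennreal (exp (\<psi> (a ## \<eta>))) * f (a ## \<eta>) \<partial>count_space UNIV)"

text \<open>Here \<open>\<theta>\<close> stands for \<open>2\<^bsup>-\<alpha>\<^esup>\<close>. Level 1 Hoelder continuity controls \<open>\<psi>\<close> only on points with a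
  common first letter, whence the condition \<open>0 < k\<close>.\<close>

locale holder_shift =
  fixes A :: "'e::countable \<Rightarrow> 'e \<Rightarrow> bool"
    and \<psi> :: "'e stream \<Rightarrow> real"
    and m :: "'e stream measure"
    and K \<theta> :: real
  assumes K_nonneg: "0 \<le> K" and theta_pos: "0 < \<theta>" and theta_less_1: "\<theta> < 1"
    and psi_variation: "x \<in> shift_space A \<Longrightarrow> y \<in> shift_space A \<Longrightarrow> 0 < k \<Longrightarrow>
      stake k x = stake k y \<Longrightarrow> \<bar>\<psi> x - \<psi> y\<bar> \<le> K * \<theta> ^ k"
    and sets_m: "sets m = sets (word_borel A)"
begin

abbreviation X :: "'e stream set" where "X \<equiv> shift_space A"

abbreviation L :: "('e stream \<Rightarrow> ennreal) \<Rightarrow> 'e stream \<Rightarrow> ennreal" where "L \<equiv> nn_transfer A \<psi>"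

abbreviation S :: "nat \<Rightarrow> 'e stream \<Rightarrow> real" where "S n x \<equiv> birkhoff_sum n (\<lambda>y. - \<psi> y) x"

lemma sets_m': "sets m = sets (restrict_space words_measure X)"
  using sets_m by (simp add: sets_word_borel)

lemma space_m: "space m = X"
  using sets_eq_imp_space_eq[OF sets_m'] by (simp add: space_restrict_space space_stream_space)

lemma borel_m: "f \<in> borel_measurable m \<longleftrightarrow> f \<in> borel_measurable (restrict_space words_measure X)"
  using measurable_cong_sets[OF sets_m' refl] by blast

lemma measurable_extend_word [measurable]:
  "(\<lambda>x. w @- x) \<in> (words_measure :: 'e stream measure) \<rightarrow>\<^sub>M words_measure"
  by (induction w) simp_all

lemma borel_measurable_extend:
  fixes f :: "'e stream \<Rightarrow> ennreal"
  assumes "f \<in> borel_measurable m"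
  shows "(\<lambda>x. indicator X (w @- x) * f (w @- x)) \<in> borel_measurable m"
proof -
  have [measurable]: "(\<lambda>x. f x * indicator X x) \<in> borel_measurable words_measure"
    using assms unfolding borel_m by (subst (asm) borel_measurable_restrict_space_iff_ennreal) auto
  have "(\<lambda>x. f (w @- x) * indicator X (w @- x)) \<in> borel_measurable words_measure"
    by (rule measurable_compose[OF measurable_extend_word]) measurable
  then show ?thesis
    unfolding borel_m by (intro measurable_restrict_space1) (simp add: mult.commute)
qed

lemma borel_measurable_drop:
  fixes f :: "'e stream \<Rightarrow> real"
  assumes "f \<in> borel_measurable m"
  shows "(\<lambda>x. f (sdrop n x)) \<in> borel_measurable m"
proof -
  have [measurable]: "(\<lambda>x. f x * indicator X x) \<in> borel_measurable words_measure"
    using assms unfolding borel_m by (subst (asm) borel_measurable_restrict_space_iff) (auto simp: mult.commute)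
  have "(\<lambda>x. f (sdrop n x) * indicator X (sdrop n x)) \<in> borel_measurable words_measure"
    by (rule measurable_compose[OF measurable_sdrop]) measurable
  then have "(\<lambda>x. f (sdrop n x) * indicator X (sdrop n x)) \<in> borel_measurable m"
    unfolding borel_m by (intro measurable_restrict_space1) (simp add: mult.commute)
  then show ?thesis
    by (rule measurable_cong[THEN iffD1, rotated]) (simp add: space_m sdrop_in_shift_space)
qed

lemma psi_continuous:
  assumes "x \<in> X" "0 < e"
  shows "\<exists>k. \<forall>y\<in>X. stake k y = stake k x \<longrightarrow> \<bar>\<psi> y - \<psi> x\<bar> < e"
proof -
  have "(\<lambda>k. K * \<theta> ^ Suc k) \<longlonglongrightarrow> K * 0"
    using theta_pos theta_less_1 by (intro tendsto_intros LIMSEQ_Suc LIMSEQ_power_zero) auto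
  then have "\<forall>\<^sub>F k in sequentially. K * \<theta> ^ Suc k < e"
    using \<open>0 < e\<close> by (intro order_tendstoD) auto
  then obtain k where "K * \<theta> ^ Suc k < e"
    by (auto simp: eventually_sequentially)
  then show ?thesis
    using psi_variation[OF _ \<open>x \<in> X\<close>, of _ "Suc k"] by (intro exI[of _ "Suc k"]) fastforce
qed

lemma psi_measurable [measurable]: "\<psi> \<in> borel_measurable m"
  unfolding borel_m using psi_continuous by (rule borel_measurable_if_continuous)

lemma S_measurable [measurable]: "S n \<in> borel_measurable m"
  unfolding birkhoff_sum_def using borel_measurable_drop[OF psi_measurable] by measurable

lemma S_Suc_snoc: "S (Suc (length w)) (w @- a ## x) = S (length w) (w @- a ## x) - \<psi> (a ## x)"
  by (simp add: birkhoff_sum_def sdrop_shift)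

lemma S_Suc_Cons: "S (Suc n) (a ## x) = S n x - \<psi> (a ## x)"
  by (simp add: birkhoff_sum_def sum.lessThan_Suc_shift del: sum.lessThan_Suc)

lemma S_0 [simp]: "S 0 x = 0"
  by (simp add: birkhoff_sum_def)

lemma cylinder_sets [measurable]: "{x \<in> X. stake k x \<in> W} \<in> sets m"
  unfolding sets_m' sets_restrict_space using stake_in_sets[of k W] by auto

lemma nn_transfer_measurable [measurable]:
  assumes [measurable]: "f \<in> borel_measurable m"
  shows "L f \<in> borel_measurable m"
proof -
  have "(\<lambda>x. indicator X (a ## x) * ennreal (exp (\<psi> (a ## x))) * f (a ## x)) \<in> borel_measurable m" for a
    using borel_measurable_extend[of "\<lambda>x. ennreal (exp (\<psi> x)) * f x" "[a]"] by (simp add: mult.assoc)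
  then show ?thesis
    unfolding nn_transfer_def[abs_def] by (rule borel_measurable_nn_integral_count_space)
qed

end

text \<open>The situation with leading eigenvalue \<open>1\<close>. The invariance of \<open>m\<close> is required for cylinders only,
  because their indicators are continuous and the dual operator acts on continuous functions.\<close>

locale renewal_shift = holder_shift A \<psi> m K \<theta>
  for A :: "'e::countable \<Rightarrow> 'e \<Rightarrow> bool"
    and \<psi> :: "'e stream \<Rightarrow> real"
    and m :: "'e stream measure"
    and K \<theta> :: real +
  fixes \<rho> :: "'e stream \<Rightarrow> real"
    and c R :: real
  assumes primitive: "finitely_primitive A"
    and c_pos: "0 < c" and psi_le: "x \<in> shift_space A \<Longrightarrow> \<psi> x \<le> - c"
    and rho_pos: "x \<in> shift_space A \<Longrightarrow> 0 < \<rho> x"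
    and rho_le: "x \<in> shift_space A \<Longrightarrow> \<rho> x \<le> R"
    and rho_continuous: "x \<in> shift_space A \<Longrightarrow> 0 < e \<Longrightarrow>
      \<exists>k. \<forall>y\<in>shift_space A. stake k y = stake k x \<longrightarrow> \<bar>\<rho> y - \<rho> x\<bar> < e"
    and rho_fixed: "x \<in> shift_space A \<Longrightarrow> nn_transfer A \<psi> (\<lambda>x. ennreal (\<rho> x)) x = ennreal (\<rho> x)"
    and prob_m: "prob_space m"
    and invariant_cylinder:
      "(\<integral>\<^sup>+x. nn_transfer A \<psi> (indicator {x \<in> shift_space A. stake k x = w}) x \<partial>m) =
        emeasure m {x \<in> shift_space A. stake k x = w}"
    and integrable_psi_rho: "integrable m (\<lambda>x. \<psi> x * \<rho> x)"
begin

sublocale prob_space m by (rule prob_m)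

lemma rho_measurable [measurable]: "\<rho> \<in> borel_measurable m"
  unfolding borel_m using rho_continuous by (rule borel_measurable_if_continuous)

lemma S_ge: "x \<in> X \<Longrightarrow> c * n \<le> S n x"
proof (induction n)
  case (Suc n)
  then show ?case
    using psi_le[OF sdrop_in_shift_space, of x n]
    by (simp add: birkhoff_sum_def algebra_simps)
qed simp

lemma S_nonneg: "x \<in> X \<Longrightarrow> 0 \<le> S n x"
  using S_ge[of x n] c_pos by (smt (verit) mult_nonneg_nonneg of_nat_0_le_iff)

lemma X_nonempty: "\<exists>x. x \<in> X"
  using not_empty unfolding space_m by blast

text \<open>The weighted push-forward \<open>\<nu>\<close> of \<open>m\<close> under all inverse branches represents \<open>f \<mapsto> \<integral>L f dm\<close>. It agrees
  with \<open>m\<close> on cylinders, so it is \<open>m\<close>.\<close>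

lemma nn_integral_nn_transfer:
  assumes f: "f \<in> borel_measurable m"
  shows "(\<integral>\<^sup>+x. L f x \<partial>m) = (\<integral>\<^sup>+x. f x \<partial>m)"
proof -
  obtain x0 where x0: "x0 \<in> X" using X_nonempty ..
  let ?C = "count_space (UNIV :: 'e set)"
  interpret C: sigma_finite_measure ?C by (rule sigma_finite_measure_count_space)
  interpret P: pair_sigma_finite ?C m ..
  \<comment> \<open>The value \<open>x0\<close> on inadmissible pairs is arbitrary: their weight \<open>w\<close> is \<open>0\<close>.\<close>
  define h where "h = (\<lambda>(a, x). if a ## x \<in> X then a ## x else x0)"
  define w where "w = (\<lambda>(a, x). indicator X (a ## x) * ennreal (exp (\<psi> (a ## x))))"
  have id_m: "(\<lambda>x. x) \<in> m \<rightarrow>\<^sub>M words_measure"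
    unfolding measurable_cong_sets[OF sets_m' refl] by (rule measurable_restrict_space1) simp
  have h: "h \<in> ?C \<Otimes>\<^sub>M m \<rightarrow>\<^sub>M m"
  proof (rule measurable_pair_measure_countable1)
    fix a :: 'e
    note id_m [measurable]
    have "(\<lambda>x. if a ## x \<in> X then a ## x else x0) \<in> m \<rightarrow>\<^sub>M words_measure"
      by (rule measurable_If) (auto simp: space_stream_space)
    then show "(\<lambda>x. h (a, x)) \<in> m \<rightarrow>\<^sub>M m"
      unfolding h_def measurable_cong_sets[OF refl sets_m']
      by (intro measurable_restrict_space2) (auto simp: x0)
  qed simp
  have w: "w \<in> borel_measurable (?C \<Otimes>\<^sub>M m)"
  proof (rule measurable_pair_measure_countable1)
    fix a :: 'e
    show "(\<lambda>x. w (a, x)) \<in> borel_measurable m"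
      using borel_measurable_extend[of "\<lambda>x. ennreal (exp (\<psi> x))" "[a]"] by (simp add: w_def)
  qed simp
  define \<nu> where "\<nu> = distr (density (?C \<Otimes>\<^sub>M m) w) m h"
  have \<nu>: "(\<integral>\<^sup>+x. g x \<partial>\<nu>) = (\<integral>\<^sup>+x. L g x \<partial>m)" if g: "g \<in> borel_measurable m" for g
  proof -
    have gh: "(\<lambda>p. g (h p)) \<in> borel_measurable (?C \<Otimes>\<^sub>M m)"
      using measurable_compose[OF h g] .
    have "(\<integral>\<^sup>+x. g x \<partial>\<nu>) = (\<integral>\<^sup>+p. w p * g (h p) \<partial>(?C \<Otimes>\<^sub>M m))"
      unfolding \<nu>_def using h w g gh
      by (subst nn_integral_distr) (auto simp: nn_integral_density)
    also have "\<dots> = (\<integral>\<^sup>+x. \<integral>\<^sup>+a. w (a, x) * g (h (a, x)) \<partial>?C \<partial>m)"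
      using w gh by (subst P.nn_integral_snd[symmetric]) auto
    also have "\<dots> = (\<integral>\<^sup>+x. L g x \<partial>m)"
      unfolding nn_transfer_def by (intro nn_integral_cong) (auto simp: w_def h_def indicator_def)
    finally show ?thesis .
  qed
  have "m = \<nu>"
  proof (rule measure_eqI_generator_eq[OF Int_stable_cylinders[of A]])
    show "range (\<lambda>(k, w). {x \<in> X. stake k x = w}) \<subseteq> Pow X" by auto
    show "sets m = sigma_sets X (range (\<lambda>(k, w). {x \<in> X. stake k x = w}))"
      "sets \<nu> = sigma_sets X (range (\<lambda>(k, w). {x \<in> X. stake k x = w}))"
      by (simp_all add: \<nu>_def sets_m sets_word_borel_cylinders)
    show "range (\<lambda>_::nat. X) \<subseteq> range (\<lambda>(k, w). {x \<in> X. stake k x = w})"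
      by (auto intro!: image_eqI[of _ _ "(0, [])"])
    fix B assume B: "B \<in> range (\<lambda>(k, w). {x \<in> X. stake k x = w})"
    then have "B \<in> sets m"
      unfolding sets_m sets_word_borel_cylinders by auto
    have "emeasure \<nu> B = (\<integral>\<^sup>+x. indicator B x \<partial>\<nu>)"
      using \<open>B \<in> sets m\<close> by (simp add: \<nu>_def)
    also have "\<dots> = (\<integral>\<^sup>+x. L (indicator B) x \<partial>m)"
      using \<open>B \<in> sets m\<close> by (intro \<nu>) auto
    also have "\<dots> = emeasure m B"
      using B invariant_cylinder by auto
    finally show "emeasure m B = emeasure \<nu> B" ..
  qed (auto simp: emeasure_eq_measure)
  then show ?thesis
    using \<nu>[OF f] by simp
qed

lemma nn_transfer_ge_term:
  "indicator X (a ## x) * ennreal (exp (\<psi> (a ## x))) * f (a ## x) \<le> L f x"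
  unfolding nn_transfer_def by (rule nn_integral_ge_point) simp

text \<open>A single inverse branch of the iterated operator, which is a lower bound for the whole sum.\<close>

lemma nn_integral_extend_le:
  assumes "f \<in> borel_measurable m"
  shows "(\<integral>\<^sup>+x. indicator X (w @- x) * (ennreal (exp (- S (length w) (w @- x))) * f (w @- x)) \<partial>m)
    \<le> (\<integral>\<^sup>+x. f x \<partial>m)"
  using assms
proof (induction w arbitrary: f)
  case Nil
  then show ?case
    by (auto intro!: nn_integral_mono simp: indicator_def)
next
  case (Cons a w)
  note [measurable] = Cons.prems
  define g where "g x = indicator X (a ## x) * ennreal (exp (\<psi> (a ## x))) * f (a ## x)" for x
  have g: "g \<in> borel_measurable m"
    using borel_measurable_extend[of "\<lambda>x. ennreal (exp (\<psi> x)) * f x" "[a]"]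
    by (simp add: g_def[abs_def] mult.assoc)
  have "(\<integral>\<^sup>+x. indicator X ((a # w) @- x) *
        (ennreal (exp (- S (length (a # w)) ((a # w) @- x))) * f ((a # w) @- x)) \<partial>m)
      = (\<integral>\<^sup>+x. indicator X (w @- x) * (ennreal (exp (- S (length w) (w @- x))) * g (w @- x)) \<partial>m)"
  proof (intro nn_integral_cong)
    fix x
    have "exp (- S (Suc (length w)) (a ## w @- x)) = exp (- S (length w) (w @- x)) * exp (\<psi> (a ## w @- x))"
      unfolding S_Suc_Cons by (simp add: exp_add[symmetric])
    moreover have "indicator X (a ## w @- x) = (indicator X (w @- x) * indicator X (a ## w @- x) :: ennreal)"
      by (auto simp: indicator_def Cons_in_shift_space)
    ultimately show "indicator X ((a # w) @- x) *
        (ennreal (exp (- S (length (a # w)) ((a # w) @- x))) * f ((a # w) @- x)) =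
      indicator X (w @- x) * (ennreal (exp (- S (length w) (w @- x))) * g (w @- x))"
      by (cases "a ## w @- x \<in> X"; cases "w @- x \<in> X")
        (simp_all add: g_def ennreal_mult mult_ac)
  qed
  also have "\<dots> \<le> (\<integral>\<^sup>+x. g x \<partial>m)"
    by (rule Cons.IH[OF g])
  also have "\<dots> \<le> (\<integral>\<^sup>+x. L f x \<partial>m)"
    unfolding g_def by (intro nn_integral_mono nn_transfer_ge_term)
  also have "\<dots> = (\<integral>\<^sup>+x. f x \<partial>m)"
    by (rule nn_integral_nn_transfer) fact
  finally show ?case .
qed

text \<open>Every point can be preceded by the prefix of \<open>x\<close> and one of finitely many connecting words. If the
  cylinder were null, each of these finitely many branches would be almost nowhere defined.\<close>

lemma cylinder_pos:
  assumes x: "x \<in> X" and "0 < k"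
  shows "0 < emeasure m {y \<in> X. stake k y = stake k x}"
proof (rule ccontr)
  let ?U = "{y \<in> X. stake k y = stake k x}"
  assume "\<not> 0 < emeasure m ?U"
  then have null: "emeasure m ?U = 0" by simp
  have [measurable]: "?U \<in> sets m" using cylinder_sets[of k "{stake k x}"] by simp
  obtain \<Lambda> where fin: "finite \<Lambda>"
    and bridge: "\<And>x y k. x \<in> X \<Longrightarrow> y \<in> X \<Longrightarrow> 0 < k \<Longrightarrow> \<exists>\<tau>\<in>\<Lambda>. (stake k x @ \<tau>) @- y \<in> X"
    using finitely_primitive_bridge[OF primitive] by metis
  have "AE y in m. (stake k x @ \<tau>) @- y \<notin> X" for \<tau>
  proof -
    define w where "w = stake k x @ \<tau>"
    define F where "F y = indicator X (w @- y) * (ennreal (exp (- S (length w) (w @- y))) * indicator ?U (w @- y))" for y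
    have "F \<in> borel_measurable m"
      unfolding F_def by (rule borel_measurable_extend) measurable
    moreover have "(\<integral>\<^sup>+y. F y \<partial>m) \<le> (\<integral>\<^sup>+y. indicator ?U y \<partial>m)"
      unfolding F_def by (rule nn_integral_extend_le) measurable
    moreover have "(\<integral>\<^sup>+y. indicator ?U y \<partial>m) = 0"
      using null by simp
    ultimately have "AE y in m. F y = 0"
      by (subst nn_integral_0_iff_AE[symmetric]) auto
    then show ?thesis
    proof eventually_elim
      case (elim y)
      have "stake k (w @- y) = stake k x"
        by (simp add: w_def stake_shift)
      with elim show ?case
        unfolding w_def[symmetric] F_def by (auto simp: indicator_def split: if_splits)
    qed
  qed
  then have "AE y in m. \<forall>\<tau>\<in>\<Lambda>. (stake k x @ \<tau>) @- y \<notin> X"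
    using fin by (intro AE_finite_allI) auto
  moreover have "AE y in m. \<exists>\<tau>\<in>\<Lambda>. (stake k x @ \<tau>) @- y \<in> X"
    using bridge[OF x _ \<open>0 < k\<close>] by (intro AE_I2) (simp add: space_m)
  ultimately have "AE y in m. False"
    by eventually_elim auto
  then show False
    by (simp add: AE_False)
qed

text \<open>A lower bound for \<open>\<psi>\<close> on the points with first letter \<open>b\<close>, where \<open>\<psi>\<close> oscillates by at most \<open>K\<close>.
  For an infinite alphabet there is no uniform lower bound.\<close>

definition psi_low :: "'e \<Rightarrow> real" where
  "psi_low b = \<psi> (SOME x. x \<in> X \<and> x !! 0 = b) - K"

lemma psi_low_le: "x \<in> X \<Longrightarrow> psi_low (x !! 0) \<le> \<psi> x"
proof -
  assume x: "x \<in> X"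
  define y where "y = (SOME y. y \<in> X \<and> y !! 0 = x !! 0)"
  have y: "y \<in> X \<and> y !! 0 = x !! 0"
    unfolding y_def by (rule someI[of _ x]) (simp add: x)
  then have "\<bar>\<psi> y - \<psi> x\<bar> \<le> K * \<theta> ^ 1"
    using x by (intro psi_variation) auto
  moreover have "K * \<theta> ^ 1 \<le> K"
    using K_nonneg theta_less_1 by (simp add: mult_left_le)
  ultimately show ?thesis
    unfolding psi_low_def y_def[symmetric] by linarith
qed

lemma S_le_word:
  "w @- x \<in> X \<Longrightarrow> S (length w) (w @- x) \<le> (\<Sum>a\<leftarrow>w. - psi_low a)"
proof (induction w)
  case (Cons a w)
  then have "w @- x \<in> X"
    by (simp add: Cons_in_shift_space)
  then show ?case
    using Cons.IH psi_low_le[OF Cons.prems] by (simp add: S_Suc_Cons)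
qed simp

lemma rho_ge_word:
  "w @- x \<in> X \<Longrightarrow> exp (- S (length w) (w @- x)) * \<rho> (w @- x) \<le> \<rho> x"
proof (induction w)
  case (Cons a w)
  let ?y = "w @- x"
  have y: "?y \<in> X" and ay: "a ## ?y \<in> X"
    using Cons.prems by (simp_all add: Cons_in_shift_space)
  have "ennreal (exp (\<psi> (a ## ?y)) * \<rho> (a ## ?y)) \<le> ennreal (\<rho> ?y)"
    using nn_transfer_ge_term[of a ?y "\<lambda>x. ennreal (\<rho> x)"] ay rho_pos[OF ay]
    by (simp add: rho_fixed[OF y] ennreal_mult)
  then have "exp (\<psi> (a ## ?y)) * \<rho> (a ## ?y) \<le> \<rho> ?y"
    using rho_pos[OF y] by (simp add: ennreal_le_iff)
  then have "exp (- S (length w) ?y) * (exp (\<psi> (a ## ?y)) * \<rho> (a ## ?y)) \<le> exp (- S (length w) ?y) * \<rho> ?y"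
    by (intro mult_left_mono) auto
  also have "\<dots> \<le> \<rho> x"
    by (rule Cons.IH[OF y])
  finally show ?case
    by (simp add: S_Suc_Cons exp_diff exp_minus field_simps)
qed simp

text \<open>Near a fixed \<open>z\<close> the function \<open>\<rho>\<close> is at least \<open>\<rho> z / 2\<close>. Harmonicity transports this
  bound to every \<open>x\<close> along a prefix of \<open>z\<close> and a connecting word; these words use finitely many letters
  only, so the weight of the branch is bounded below.\<close>

lemma rho_lower_bound: "\<exists>r>0. \<forall>x\<in>X. r \<le> \<rho> x"
proof -
  obtain \<Lambda> where fin: "finite \<Lambda>"
    and bridge: "\<And>x y k. x \<in> X \<Longrightarrow> y \<in> X \<Longrightarrow> 0 < k \<Longrightarrow> \<exists>\<tau>\<in>\<Lambda>. (stake k x @ \<tau>) @- y \<in> X"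
    using finitely_primitive_bridge[OF primitive] by metis
  obtain z where z: "z \<in> X" using X_nonempty ..
  obtain k where k: "\<forall>y\<in>X. stake k y = stake k z \<longrightarrow> \<bar>\<rho> y - \<rho> z\<bar> < \<rho> z / 2"
    using rho_continuous[OF z, of "\<rho> z / 2"] rho_pos[OF z] by auto
  let ?w = "stake (Suc k) z"
  \<comment> \<open>The largest possible time of a branch through \<open>?w\<close> and a connecting word.\<close>
  define B where "B = Max ((\<lambda>\<tau>. \<Sum>a\<leftarrow>?w @ \<tau>. - psi_low a) ` \<Lambda>)"
  have "exp (- B) * (\<rho> z / 2) \<le> \<rho> x" if x: "x \<in> X" for x
  proof -
    obtain \<tau> where \<tau>: "\<tau> \<in> \<Lambda>" "(?w @ \<tau>) @- x \<in> X"
      using bridge[OF z x, of "Suc k"] by blast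
    have "(\<Sum>a\<leftarrow>?w @ \<tau>. - psi_low a) \<le> B"
      unfolding B_def using fin \<tau>(1) by (intro Max_ge) auto
    then have "S (length (?w @ \<tau>)) ((?w @ \<tau>) @- x) \<le> B"
      using S_le_word[OF \<tau>(2)] by linarith
    moreover have "stake (Suc k) ((?w @ \<tau>) @- x) = ?w"
      by (simp add: stake_shift del: stake.simps)
    then have "stake k ((?w @ \<tau>) @- x) = stake k z"
      by (rule stake_eq_mono) simp
    then have "\<rho> z / 2 \<le> \<rho> ((?w @ \<tau>) @- x)"
      using k \<tau>(2) by (smt (verit) field_sum_of_halves)
    ultimately have "exp (- B) * (\<rho> z / 2) \<le>
        exp (- S (length (?w @ \<tau>)) ((?w @ \<tau>) @- x)) * \<rho> ((?w @ \<tau>) @- x)"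
      using rho_pos[OF z] by (intro mult_mono) auto
    also have "\<dots> \<le> \<rho> x"
      by (rule rho_ge_word[OF \<tau>(2)])
    finally show ?thesis .
  qed
  then show ?thesis
    using rho_pos[OF z] by (intro exI[of _ "exp (- B) * (\<rho> z / 2)"]) auto
qed

section \<open>Renewal sums over backward orbits\<close>

definition rho_low :: real where
  "rho_low = (SOME r. 0 < r \<and> (\<forall>x\<in>X. r \<le> \<rho> x))"

lemma rho_low: "0 < rho_low" "x \<in> X \<Longrightarrow> rho_low \<le> \<rho> x"
proof -
  have "0 < rho_low \<and> (\<forall>x\<in>X. rho_low \<le> \<rho> x)"
    unfolding rho_low_def using rho_lower_bound by (rule someI_ex[OF ex_forward]) auto
  then show "0 < rho_low" "x \<in> X \<Longrightarrow> rho_low \<le> \<rho> x" by auto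
qed

lemma R_pos: "0 < R"
  using X_nonempty rho_pos rho_le by (meson less_le_trans)

text \<open>The summand depends on the length of \<open>w\<close> and on the point \<open>w @- x\<close> only; the base point \<open>x\<close>
  can be recovered from these by dropping letters.\<close>

definition word_sum :: "(nat \<Rightarrow> 'e stream \<Rightarrow> ennreal) \<Rightarrow> 'e stream \<Rightarrow> ennreal" where
  "word_sum F x = (\<integral>\<^sup>+w. indicator X (w @- x) * F (length w) (w @- x) \<partial>count_space UNIV)"

text \<open>The weight \<open>g\<close> is evaluated at the endpoint and the kernel \<open>\<kappa>\<close> at the time \<open>S\<close> of the orbit. Different
  kernels give the mass up to a time, in a time window, and its primitive.\<close>

definition orbit_sum :: "('e stream \<Rightarrow> ennreal) \<Rightarrow> (real \<Rightarrow> ennreal) \<Rightarrow> 'e stream \<Rightarrow> ennreal" where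
  "orbit_sum g \<kappa> = word_sum (\<lambda>n y. ennreal (exp (- S n y)) * \<kappa> (S n y) * g y)"

lemma word_sum_measurable:
  assumes "\<And>n. F n \<in> borel_measurable m"
  shows "word_sum F \<in> borel_measurable m"
  unfolding word_sum_def[abs_def]
  by (intro borel_measurable_nn_integral_count_space borel_measurable_extend assms)

lemma word_sum_cong:
  assumes "\<And>w. w @- x \<in> X \<Longrightarrow> F (length w) (w @- x) = G (length w) (w @- x)"
  shows "word_sum F x = word_sum G x"
  unfolding word_sum_def using assms by (intro nn_integral_cong) (auto simp: indicator_def)

lemma word_sum_mono:
  assumes "\<And>w. w @- x \<in> X \<Longrightarrow> F (length w) (w @- x) \<le> G (length w) (w @- x)"
  shows "word_sum F x \<le> word_sum G x"
  unfolding word_sum_def using assms by (intro nn_integral_mono) (auto simp: indicator_def)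

lemma word_sum_add: "word_sum (\<lambda>n y. F n y + G n y) x = word_sum F x + word_sum G x"
  unfolding word_sum_def by (simp add: nn_integral_add distrib_left)

lemma word_sum_cmult: "word_sum (\<lambda>n y. C * F n y) x = C * word_sum F x"
  unfolding word_sum_def by (simp add: nn_integral_cmult mult.left_commute)

lemma word_sum_zero: "x \<notin> X \<Longrightarrow> word_sum F x = 0"
  unfolding word_sum_def using shift_space_suffix by (auto simp: indicator_def nn_integral_0_iff_AE)

lemma word_sum_renewal:
  "word_sum F x = indicator X x * F 0 x +
    (\<integral>\<^sup>+a. indicator X (a ## x) * word_sum (\<lambda>n. F (Suc n)) (a ## x) \<partial>count_space UNIV)"
proof -
  have "word_sum (\<lambda>n. F (Suc n)) (a ## x) = indicator X (a ## x) * word_sum (\<lambda>n. F (Suc n)) (a ## x)" for a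
    by (cases "a ## x \<in> X") (simp_all add: word_sum_zero)
  then show ?thesis
    unfolding word_sum_def by (subst nn_integral_count_space_snoc) simp
qed

lemma orbit_sum_renewal:
  "orbit_sum g \<kappa> x = indicator X x * \<kappa> 0 * g x +
    L (\<lambda>y. orbit_sum g (\<lambda>s. \<kappa> (s - \<psi> y)) y) x"
proof -
  have "word_sum (\<lambda>n y. ennreal (exp (- S (Suc n) y)) * \<kappa> (S (Suc n) y) * g y) (a ## x)
      = ennreal (exp (\<psi> (a ## x))) * orbit_sum g (\<lambda>s. \<kappa> (s - \<psi> (a ## x))) (a ## x)" for a
    unfolding orbit_sum_def word_sum_cmult[symmetric]
  proof (rule word_sum_cong)
    fix w
    have "exp (- S (Suc (length w)) (w @- a ## x)) = exp (\<psi> (a ## x)) * exp (- S (length w) (w @- a ## x))"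
      unfolding S_Suc_snoc by (simp add: exp_add[symmetric])
    then show "ennreal (exp (- S (Suc (length w)) (w @- a ## x))) * \<kappa> (S (Suc (length w)) (w @- a ## x)) * g (w @- a ## x)
      = ennreal (exp (\<psi> (a ## x))) * (ennreal (exp (- S (length w) (w @- a ## x))) *
          \<kappa> (S (length w) (w @- a ## x) - \<psi> (a ## x)) * g (w @- a ## x))"
      by (simp add: S_Suc_snoc ennreal_mult mult.assoc)
  qed
  then show ?thesis
    unfolding nn_transfer_def orbit_sum_def[of g \<kappa>]
    by (subst word_sum_renewal) (simp add: mult.assoc)
qed

lemma orbit_sum_mono:
  assumes "\<And>s. 0 \<le> s \<Longrightarrow> \<kappa> s \<le> \<kappa>' s" "\<And>y. y \<in> X \<Longrightarrow> g y \<le> g' y"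
  shows "orbit_sum g \<kappa> x \<le> orbit_sum g' \<kappa>' x"
  unfolding orbit_sum_def
  by (intro word_sum_mono mult_mono assms order_refl S_nonneg) auto

lemma orbit_sum_add:
  "orbit_sum g (\<lambda>s. \<kappa> s + \<kappa>' s) x = orbit_sum g \<kappa> x + orbit_sum g \<kappa>' x"
  unfolding orbit_sum_def word_sum_add[symmetric] by (simp add: algebra_simps)

lemma orbit_sum_cmult_weight: "orbit_sum (\<lambda>y. C * g y) \<kappa> x = C * orbit_sum g \<kappa> x"
  unfolding orbit_sum_def word_sum_cmult[symmetric] by (simp add: mult_ac)

lemma orbit_sum_cmult: "orbit_sum g (\<lambda>s. C * \<kappa> s) x = C * orbit_sum g \<kappa> x"
  unfolding orbit_sum_def word_sum_cmult[symmetric] by (simp add: mult_ac)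

lemma orbit_sum_eq_0: "(\<And>s. 0 \<le> s \<Longrightarrow> \<kappa> s = 0) \<Longrightarrow> orbit_sum g \<kappa> x = 0"
  using orbit_sum_mono[of \<kappa> "\<lambda>_. 0" g g x] orbit_sum_cmult[of g 0 "\<lambda>_. 0" x] by simp

lemma nn_transfer_mono:
  "(\<And>a. a ## x \<in> X \<Longrightarrow> f (a ## x) \<le> g (a ## x)) \<Longrightarrow> L f x \<le> L g x"
  unfolding nn_transfer_def by (intro nn_integral_mono) (auto simp: indicator_def intro!: mult_left_mono)

lemma nn_transfer_cong:
  "(\<And>a. a ## x \<in> X \<Longrightarrow> f (a ## x) = g (a ## x)) \<Longrightarrow> L f x = L g x"
  by (intro antisym nn_transfer_mono) auto

lemma nn_transfer_add: "L (\<lambda>y. f y + g y) x = L f x + L g x"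
  unfolding nn_transfer_def by (simp add: nn_integral_add distrib_left)

lemma nn_transfer_cmult: "L (\<lambda>y. C * f y) x = C * L f x"
  unfolding nn_transfer_def by (simp add: nn_integral_cmult mult.left_commute)

text \<open>The sum is the expected number of visits to a window of length \<open>c\<close>, for the Markov chain obtained from \<open>L\<close>
  by normalising with \<open>\<rho>\<close>, multiplied by \<open>\<rho> x\<close>. Every step takes at least time \<open>c\<close>, so there is at most one visit. In the
  renewal equation, either the empty word is in the window and the remaining sum is empty, or
  the window is moved back by at least \<open>c\<close>, which is the induction step.\<close>

lemma window_sum_le_rho:
  assumes "x \<in> X"
  shows "orbit_sum (\<lambda>y. ennreal (\<rho> y)) (indicator {T<..T + c}) x \<le> ennreal (\<rho> x)"
proof -
  have base: "orbit_sum (\<lambda>y. ennreal (\<rho> y)) (indicator {T<..T + c}) x \<le> ennreal (\<rho> x)"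
    if "x \<in> X" "T < 0" for x T
  proof -
    have "L (\<lambda>y. orbit_sum (\<lambda>y. ennreal (\<rho> y)) (\<lambda>s. indicator {T<..T + c} (s - \<psi> y)) y) x = L (\<lambda>y. 0) x"
      using psi_le \<open>T < 0\<close>
      by (intro nn_transfer_cong orbit_sum_eq_0) (force simp: indicator_def)
    then show ?thesis
      using \<open>x \<in> X\<close> nn_transfer_cmult[of 0 "\<lambda>_. 0" x]
      by (subst orbit_sum_renewal) (auto simp: indicator_def)
  qed
  have "orbit_sum (\<lambda>y. ennreal (\<rho> y)) (indicator {T<..T + c}) x \<le> ennreal (\<rho> x)"
    if "x \<in> X" "T < real n * c" for x T n
    using that
  proof (induction n arbitrary: x T)
    case 0
    then show ?case using base by simp
  next
    case (Suc n)
    show ?case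
    proof (cases "T < 0")
      case True
      then show ?thesis using base Suc.prems by simp
    next
      case False
      have "L (\<lambda>y. orbit_sum (\<lambda>y. ennreal (\<rho> y)) (\<lambda>s. indicator {T<..T + c} (s - \<psi> y)) y) x
          \<le> L (\<lambda>y. ennreal (\<rho> y)) x"
      proof (rule nn_transfer_mono)
        fix a assume ax: "a ## x \<in> X"
        have "(\<lambda>s. indicator {T<..T + c} (s - \<psi> (a ## x)) :: ennreal) =
            indicator {T + \<psi> (a ## x)<..T + \<psi> (a ## x) + c}"
          by (auto simp: indicator_def fun_eq_iff)
        moreover have "T + \<psi> (a ## x) < real n * c"
          using psi_le[OF ax] Suc.prems by (simp add: algebra_simps)
        ultimately show "orbit_sum (\<lambda>y. ennreal (\<rho> y)) (\<lambda>s. indicator {T<..T + c} (s - \<psi> (a ## x))) (a ## x)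
            \<le> ennreal (\<rho> (a ## x))"
          using Suc.IH[OF ax] by simp
      qed
      then show ?thesis
        using False Suc.prems by (subst orbit_sum_renewal) (simp add: rho_fixed)
    qed
  qed
  moreover obtain n :: nat where "T < real n * c"
    using reals_Archimedean3[OF c_pos] by metis
  ultimately show ?thesis
    using assms by blast
qed

definition window_bound :: real where "window_bound = R / rho_low"

lemma window_bound_pos: "0 < window_bound"
  using R_pos rho_low(1) by (simp add: window_bound_def)

lemma window_sum_le:
  assumes "x \<in> X"
  shows "orbit_sum (\<lambda>_. 1) (indicator {T<..T + c}) x \<le> ennreal window_bound"
proof -
  have "1 \<le> ennreal (1 / rho_low) * ennreal (\<rho> y)" if "y \<in> X" for y
    using rho_low(1) rho_low(2)[OF that]
    by (simp add: ennreal_mult[symmetric] del: ennreal_1 flip: ennreal_1)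
  then have "orbit_sum (\<lambda>_. 1) (indicator {T<..T + c}) x
      \<le> orbit_sum (\<lambda>y. ennreal (1 / rho_low) * ennreal (\<rho> y)) (indicator {T<..T + c}) x"
    by (intro orbit_sum_mono) auto
  also have "\<dots> \<le> ennreal (1 / rho_low) * ennreal (\<rho> x)"
    unfolding orbit_sum_cmult_weight by (intro mult_left_mono window_sum_le_rho assms) auto
  also have "\<dots> \<le> ennreal window_bound"
    using rho_low(1) rho_le[OF assms] rho_pos[OF assms]
    by (simp add: ennreal_mult[symmetric] window_bound_def divide_right_mono)
  finally show ?thesis .
qed

lemma long_window_sum_le:
  assumes "x \<in> X" "0 \<le> h"
  shows "orbit_sum (\<lambda>_. 1) (indicator {T<..T + h}) x \<le> ennreal (window_bound * (h / c + 1))"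
proof -
  have steps: "orbit_sum (\<lambda>_. 1) (indicator {T<..T + real N * c}) x \<le> ennreal (window_bound * real N)" for N
  proof (induction N)
    case 0
    then show ?case by (simp add: orbit_sum_eq_0)
  next
    case (Suc N)
    have "orbit_sum (\<lambda>_. 1) (indicator {T<..T + real (Suc N) * c}) x \<le>
        orbit_sum (\<lambda>_. 1) (\<lambda>s. indicator {T<..T + real N * c} s +
          indicator {T + real N * c<..T + real N * c + c} s) x"
      by (intro orbit_sum_mono) (auto simp: indicator_def algebra_simps)
    also have "\<dots> \<le> ennreal (window_bound * real N) + ennreal window_bound"
      unfolding orbit_sum_add using Suc.IH window_sum_le[OF \<open>x \<in> X\<close>] by (rule add_mono)
    also have "\<dots> = ennreal (window_bound * real (Suc N))"
      using window_bound_pos by (simp add: ennreal_plus[symmetric] algebra_simps del: ennreal_plus)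
    finally show ?case .
  qed
  define N where "N = nat \<lceil>h / c\<rceil>"
  have N: "h / c \<le> real N" "real N \<le> h / c + 1"
    using assms(2) c_pos unfolding N_def by (auto simp: of_nat_nat)
  have "h \<le> real N * c"
    using N(1) c_pos by (simp add: field_simps)
  then have "orbit_sum (\<lambda>_. 1) (indicator {T<..T + h}) x \<le> ennreal (window_bound * real N)"
    by (intro order_trans[OF orbit_sum_mono steps]) (auto simp: indicator_def)
  also have "\<dots> \<le> ennreal (window_bound * (h / c + 1))"
    using N(2) window_bound_pos by (intro ennreal_leI mult_left_mono) auto
  finally show ?thesis .
qed

definition nn_mass :: "'e stream set \<Rightarrow> real \<Rightarrow> 'e stream \<Rightarrow> ennreal" where
  "nn_mass G T = orbit_sum (indicator G) (indicator {..T})"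

definition mass :: "'e stream set \<Rightarrow> real \<Rightarrow> 'e stream \<Rightarrow> real" where
  "mass G T x = enn2real (nn_mass G T x)"

lemma nn_mass_mono: "T \<le> T' \<Longrightarrow> nn_mass G T x \<le> nn_mass G T' x"
  unfolding nn_mass_def by (intro orbit_sum_mono) (auto simp: indicator_def)

lemma nn_mass_bound:
  assumes "x \<in> X" "0 \<le> T"
  shows "nn_mass G T x \<le> ennreal (window_bound * (T / c + 2))"
proof -
  \<comment> \<open>Times are nonnegative, so they lie in a half-open window that starts below \<open>0\<close>.\<close>
  have "nn_mass G T x \<le> orbit_sum (\<lambda>_. 1) (indicator {- c<..- c + (T + c)}) x"
    unfolding nn_mass_def using c_pos by (intro orbit_sum_mono) (auto simp: indicator_def)
  also have "\<dots> \<le> ennreal (window_bound * ((T + c) / c + 1))"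
    using assms c_pos by (intro long_window_sum_le) auto
  also have "(T + c) / c + 1 = T / c + 2"
    using c_pos by (simp add: field_simps)
  finally show ?thesis .
qed

lemma ennreal_mass: "x \<in> X \<Longrightarrow> ennreal (mass G T x) = nn_mass G T x"
  unfolding mass_def
  using nn_mass_mono[of T "max 0 T" G x] nn_mass_bound[of x "max 0 T" G]
  by (intro ennreal_enn2real) (auto simp: top_unique le_less_trans ennreal_less_top)

lemma mass_nonneg [simp]: "0 \<le> mass G T x"
  by (simp add: mass_def)

lemma mass_le: "x \<in> X \<Longrightarrow> 0 \<le> T \<Longrightarrow> mass G T x \<le> window_bound * (T / c + 2)"
  using nn_mass_bound[of x T G] window_bound_pos c_pos by (simp add: ennreal_mass[symmetric] ennreal_le_iff)

lemma mass_mono: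
  assumes "x \<in> X" "T \<le> T'" "X \<inter> G \<subseteq> G'"
  shows "mass G T x \<le> mass G' T' x"
proof -
  have "nn_mass G T x \<le> nn_mass G' T' x"
    unfolding nn_mass_def using assms by (intro orbit_sum_mono) (auto simp: indicator_def)
  then show ?thesis
    using assms(1) by (simp add: ennreal_mass[symmetric])
qed

lemma mass_increment:
  assumes "x \<in> X" "0 \<le> h"
  shows "mass G (T + h) x \<le> mass G T x + window_bound * (h / c + 1)"
proof -
  have "nn_mass G (T + h) x \<le> orbit_sum (indicator G) (\<lambda>s. indicator {..T} s + indicator {T<..T + h} s) x"
    unfolding nn_mass_def by (intro orbit_sum_mono) (auto simp: indicator_def)
  also have "\<dots> = nn_mass G T x + orbit_sum (indicator G) (indicator {T<..T + h}) x"
    by (simp add: orbit_sum_add nn_mass_def)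
  also have "\<dots> \<le> nn_mass G T x + orbit_sum (\<lambda>_. 1) (indicator {T<..T + h}) x"
    by (intro add_left_mono orbit_sum_mono) (auto simp: indicator_def)
  also have "\<dots> \<le> nn_mass G T x + ennreal (window_bound * (h / c + 1))"
    by (intro add_left_mono long_window_sum_le assms)
  also have "\<dots> = ennreal (mass G T x + window_bound * (h / c + 1))"
    using assms window_bound_pos c_pos by (subst ennreal_plus) (auto simp: ennreal_mass)
  finally have "ennreal (mass G (T + h) x) \<le> ennreal (mass G T x + window_bound * (h / c + 1))"
    using assms by (simp only: ennreal_mass)
  then show ?thesis
    using assms window_bound_pos c_pos by (subst (asm) ennreal_le_iff) auto
qed

definition distortion :: real where "distortion = K / (1 - \<theta>)"

lemma distortion_nonneg: "0 \<le> distortion"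
  using K_nonneg theta_less_1 by (simp add: distortion_def)

text \<open>After \<open>i\<close> further letters the two orbits agree on \<open>k + i\<close> letters, so the differences form a geometric
  series.\<close>

lemma S_distortion:
  assumes "x \<in> X" "y \<in> X" "0 < k" "stake k x = stake k y" "w @- x \<in> X"
  shows "\<bar>S (length w) (w @- x) - S (length w) (w @- y)\<bar> \<le> distortion * \<theta> ^ k"
proof -
  have "\<bar>S (length w) (w @- x) - S (length w) (w @- y)\<bar> \<le> K * \<theta> ^ k * (\<Sum>i<length w. \<theta> ^ i)"
    using assms(5)
  proof (induction w)
    case (Cons a w)
    have wx: "w @- x \<in> X" and awy: "a ## w @- y \<in> X"
      using Cons.prems shift_in_shift_space_cong[OF assms(1,2,4,3), of "a # w"]
      by (simp_all add: Cons_in_shift_space)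
    have "stake (k + Suc (length w)) ((a # w) @- x) = stake (k + Suc (length w)) ((a # w) @- y)"
      unfolding stake_shift using assms(4) by simp
    then have "\<bar>\<psi> (a ## w @- x) - \<psi> (a ## w @- y)\<bar> \<le> K * \<theta> ^ (k + Suc (length w))"
      using Cons.prems awy by (intro psi_variation) auto
    also have "\<dots> \<le> K * \<theta> ^ (k + length w)"
      using K_nonneg theta_pos theta_less_1 by (intro mult_left_mono power_decreasing) auto
    finally have "\<bar>\<psi> (a ## w @- x) - \<psi> (a ## w @- y)\<bar> \<le> K * \<theta> ^ k * \<theta> ^ length w"
      by (simp add: power_add mult.assoc)
    then show ?case
      using Cons.IH[OF wx] by (simp add: S_Suc_Cons distrib_left)
  qed simp
  also have "(\<Sum>i<length w. \<theta> ^ i) \<le> 1 / (1 - \<theta>)"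
    using theta_pos theta_less_1 by (simp add: sum_gp_strict divide_right_mono)
  then have "K * \<theta> ^ k * (\<Sum>i<length w. \<theta> ^ i) \<le> K * \<theta> ^ k * (1 / (1 - \<theta>))"
    using K_nonneg theta_pos by (intro mult_left_mono) auto
  finally show ?thesis
    by (simp add: distortion_def mult.commute)
qed

text \<open>By distortion, passing from \<open>y\<close> to \<open>x\<close> changes every weight by at most the factor \<open>e\<^sup>\<delta>\<close> and every time
  by at most \<open>\<delta>\<close>, where \<open>\<delta>\<close> is the distortion bound; the delay adds an amount of mass that is bounded in \<open>T\<close>.\<close>

lemma mass_compare:
  assumes "x \<in> X" "y \<in> X" "0 < k" "j \<le> k" "stake k x = stake k y"
  shows "mass {z. stake j z \<in> W} T y \<le> exp (distortion * \<theta> ^ k) *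
    (mass {z. stake j z \<in> W} T x + window_bound * (distortion * \<theta> ^ k / c + 1))"
proof -
  let ?G = "{z. stake j z \<in> W}" and ?d = "distortion * \<theta> ^ k"
  have d: "0 \<le> ?d" using distortion_nonneg theta_pos by simp
  have "nn_mass ?G T y \<le> ennreal (exp ?d) * nn_mass ?G (T + ?d) x"
    unfolding nn_mass_def orbit_sum_def word_sum_cmult[symmetric] unfolding word_sum_def
  proof (intro nn_integral_mono)
    fix w :: "'e list"
    let ?n = "length w"
    have X_iff: "w @- x \<in> X \<longleftrightarrow> w @- y \<in> X"
      using assms by (intro shift_in_shift_space_cong) auto
    show "indicator X (w @- y) *
        (ennreal (exp (- S ?n (w @- y))) * indicator {..T} (S ?n (w @- y)) * indicator ?G (w @- y))
      \<le> indicator X (w @- x) * (ennreal (exp ?d) * (ennreal (exp (- S ?n (w @- x))) *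
          indicator {..T + ?d} (S ?n (w @- x)) * indicator ?G (w @- x)))"
    proof (cases "w @- y \<in> X \<and> S ?n (w @- y) \<le> T \<and> w @- y \<in> ?G")
      case True
      have dist: "\<bar>S ?n (w @- x) - S ?n (w @- y)\<bar> \<le> ?d"
        using True X_iff by (intro S_distortion assms) auto
      have "stake (j - length w) x = stake (j - length w) y"
        using assms(4,5) by (intro stake_eq_mono[OF assms(5)]) auto
      then have "w @- x \<in> ?G"
        using True by (simp add: stake_shift)
      moreover have "exp (- S ?n (w @- y)) \<le> exp ?d * exp (- S ?n (w @- x))"
        unfolding exp_add[symmetric] using dist by simp
      then have "ennreal (exp (- S ?n (w @- y))) \<le> ennreal (exp ?d) * ennreal (exp (- S ?n (w @- x)))"
        by (simp add: ennreal_mult[symmetric])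
      moreover have "S ?n (w @- x) \<le> T + ?d"
        using dist True by linarith
      ultimately show ?thesis
        using True X_iff by simp
    qed (auto simp: indicator_def)
  qed
  then have "ennreal (mass ?G T y) \<le> ennreal (exp ?d * mass ?G (T + ?d) x)"
    using assms by (simp add: ennreal_mass ennreal_mult)
  then have "mass ?G T y \<le> exp ?d * mass ?G (T + ?d) x"
    by (subst (asm) ennreal_le_iff) auto
  also have "\<dots> \<le> exp ?d * (mass ?G T x + window_bound * (?d / c + 1))"
    using mass_increment[OF \<open>x \<in> X\<close> d] by (intro mult_left_mono) auto
  finally show ?thesis .
qed

definition mean_bound :: real where "mean_bound = window_bound * (1 / c + 2)"

lemma mean_bound_pos: "0 < mean_bound"
  using window_bound_pos c_pos by (simp add: mean_bound_def add_pos_pos)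

lemma mass_average_le:
  assumes "x \<in> X" "1 \<le> T"
  shows "mass G T x / T \<le> mean_bound"
proof -
  have "mass G T x \<le> window_bound * (T / c + 2)"
    using assms by (intro mass_le) auto
  also have "\<dots> \<le> window_bound * ((1 / c + 2) * T)"
    using window_bound_pos \<open>1 \<le> T\<close> by (intro mult_left_mono) (auto simp: algebra_simps)
  finally show ?thesis
    using assms by (simp add: mean_bound_def field_simps)
qed

lemma mass_average_compare:
  assumes "x \<in> X" "y \<in> X" "0 < k" "j \<le> k" "stake k x = stake k y" "distortion * \<theta> ^ k \<le> 1" "1 \<le> T"
  shows "\<bar>mass {z. stake j z \<in> W} T y / T - mass {z. stake j z \<in> W} T x / T\<bar> \<le>
    (exp (distortion * \<theta> ^ k) - 1) * mean_bound + exp 1 * (window_bound * (1 / c + 1)) / T"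
proof -
  let ?G = "{z. stake j z \<in> W}" and ?d = "distortion * \<theta> ^ k"
  have d: "0 \<le> ?d" using distortion_nonneg theta_pos by simp
  have "mass ?G T y / T - mass ?G T x / T \<le> (exp ?d - 1) * mean_bound + exp 1 * (window_bound * (1 / c + 1)) / T"
    if "x \<in> X" "y \<in> X" "stake k x = stake k y" for x y
  proof -
    have "mass ?G T y \<le> exp ?d * (mass ?G T x + window_bound * (?d / c + 1))"
      using that assms by (intro mass_compare) auto
    also have "\<dots> = exp ?d * mass ?G T x + exp ?d * (window_bound * (?d / c + 1))"
      by (simp add: distrib_left)
    also have "\<dots> \<le> exp ?d * mass ?G T x + exp 1 * (window_bound * (1 / c + 1))"
      using assms(6) d window_bound_pos c_pos
      by (intro add_left_mono mult_mono add_mono divide_right_mono) auto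
    finally have "mass ?G T y / T \<le> (exp ?d * mass ?G T x + exp 1 * (window_bound * (1 / c + 1))) / T"
      using \<open>1 \<le> T\<close> by (intro divide_right_mono) auto
    also have "\<dots> = exp ?d * (mass ?G T x / T) + exp 1 * (window_bound * (1 / c + 1)) / T"
      by (simp add: add_divide_distrib)
    finally have "mass ?G T y / T - mass ?G T x / T \<le>
        (exp ?d - 1) * (mass ?G T x / T) + exp 1 * (window_bound * (1 / c + 1)) / T"
      by (simp add: left_diff_distrib diff_divide_distrib)
    moreover have "(exp ?d - 1) * (mass ?G T x / T) \<le> (exp ?d - 1) * mean_bound"
      using d by (intro mult_left_mono mass_average_le that assms) auto
    ultimately show ?thesis by linarith
  qed
  from this[OF assms(1,2,5)] this[OF assms(2,1) assms(5)[symmetric]] show ?thesis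
    by linarith
qed

text \<open>The time average of the mass relative to the harmonic function; its limit will not depend on \<open>x\<close>.\<close>

definition rel_mass :: "'e stream set \<Rightarrow> real \<Rightarrow> 'e stream \<Rightarrow> real" where
  "rel_mass G T x = mass G T x / T / \<rho> x"

text \<open>The mass has jumps in \<open>x\<close>, but these are bounded in \<open>T\<close> and disappear in the average. So continuity
  holds with a neighbourhood that serves all large times at once.\<close>

lemma rel_mass_asymptotically_continuous:
  assumes x: "x \<in> X" and "0 < e"
  shows "\<exists>k T0. \<forall>y\<in>X. \<forall>T\<ge>T0. stake k y = stake k x \<longrightarrow>
    \<bar>rel_mass {z. stake j z \<in> W} T y - rel_mass {z. stake j z \<in> W} T x\<bar> < e"
proof -
  let ?G = "{z. stake j z \<in> W}"
  \<comment> \<open>The averages will differ by less than \<open>2 * e1\<close> and the values of \<open>\<rho>\<close> by less than \<open>e2\<close>; each contributes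
    at most \<open>e / 2\<close> to the difference of the quotients.\<close>
  define e1 where "e1 = e * rho_low / 4"
  define e2 where "e2 = e * rho_low * rho_low / (2 * mean_bound)"
  have e1: "0 < e1" and e2: "0 < e2"
    using \<open>0 < e\<close> rho_low(1) mean_bound_pos by (simp_all add: e1_def e2_def)
  obtain k1 where k1: "\<forall>y\<in>X. stake k1 y = stake k1 x \<longrightarrow> \<bar>\<rho> y - \<rho> x\<bar> < e2"
    using rho_continuous[OF x e2] by blast
  have "(\<lambda>k. distortion * \<theta> ^ k) \<longlonglongrightarrow> distortion * 0"
    using theta_pos theta_less_1 by (intro tendsto_intros LIMSEQ_power_zero) auto
  then have lim: "(\<lambda>k. distortion * \<theta> ^ k) \<longlonglongrightarrow> 0" by simp
  have "(\<lambda>k. (exp (distortion * \<theta> ^ k) - 1) * mean_bound) \<longlonglongrightarrow> (exp 0 - 1) * mean_bound"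
    by (intro tendsto_intros lim)
  then have "\<forall>\<^sub>F k in sequentially. (exp (distortion * \<theta> ^ k) - 1) * mean_bound < e1"
    using e1 by (intro order_tendstoD) auto
  moreover have "\<forall>\<^sub>F k in sequentially. distortion * \<theta> ^ k < 1"
    using lim by (rule order_tendstoD) simp
  ultimately have "\<forall>\<^sub>F k in sequentially. (exp (distortion * \<theta> ^ k) - 1) * mean_bound < e1 \<and> distortion * \<theta> ^ k < 1 \<and>
      k1 \<le> k \<and> j \<le> k \<and> 0 < k"
    using eventually_ge_at_top[of k1] eventually_ge_at_top[of j] eventually_gt_at_top[of 0]
    by eventually_elim auto
  then obtain k where k: "(exp (distortion * \<theta> ^ k) - 1) * mean_bound < e1" "distortion * \<theta> ^ k < 1" "k1 \<le> k" "j \<le> k" "0 < k"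
    by (auto dest: eventually_happens)
  define T0 where "T0 = max 1 (exp 1 * (window_bound * (1 / c + 1)) / e1)"
  show ?thesis
  proof (intro exI ballI allI impI)
    fix y T assume y: "y \<in> X" and "T0 \<le> T" and yx: "stake k y = stake k x"
    then have T: "1 \<le> T" "exp 1 * (window_bound * (1 / c + 1)) / e1 \<le> T"
      unfolding T0_def by auto
    have "exp 1 * (window_bound * (1 / c + 1)) / T \<le> e1"
      using T e1 by (simp add: field_simps)
    then have diff: "\<bar>mass ?G T y / T - mass ?G T x / T\<bar> < 2 * e1"
      using mass_average_compare[OF x y \<open>0 < k\<close> \<open>j \<le> k\<close> yx[symmetric] _ T(1), of W] k(1,2) by linarith
    have rho_diff: "\<bar>\<rho> y - \<rho> x\<bar> < e2"
      using k1 y stake_eq_mono[OF yx k(3)] by blast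
    have "\<bar>rel_mass ?G T y - rel_mass ?G T x\<bar> =
        \<bar>(mass ?G T y / T - mass ?G T x / T) / \<rho> y + mass ?G T x / T * (\<rho> x - \<rho> y) / (\<rho> x * \<rho> y)\<bar>"
      unfolding rel_mass_def using rho_pos[OF x] rho_pos[OF y] T(1) by (simp add: field_simps)
    also have "\<dots> \<le> \<bar>mass ?G T y / T - mass ?G T x / T\<bar> / \<rho> y + mass ?G T x / T * \<bar>\<rho> y - \<rho> x\<bar> / (\<rho> x * \<rho> y)"
      using rho_pos[OF x] rho_pos[OF y] T(1)
      by (intro order_trans[OF abs_triangle_ineq]) (simp add: abs_mult abs_minus_commute)
    also have "\<dots> < 2 * e1 / rho_low + mean_bound * e2 / (rho_low * rho_low)"
    proof (intro add_less_le_mono)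
      have "\<bar>mass ?G T y / T - mass ?G T x / T\<bar> / \<rho> y \<le> \<bar>mass ?G T y / T - mass ?G T x / T\<bar> / rho_low"
        using rho_low(1) rho_low(2)[OF y] by (intro divide_left_mono mult_pos_pos) auto
      also have "\<dots> < 2 * e1 / rho_low"
        using diff rho_low(1) by (intro divide_strict_right_mono)
      finally show "\<bar>mass ?G T y / T - mass ?G T x / T\<bar> / \<rho> y < 2 * e1 / rho_low" .
      show "mass ?G T x / T * \<bar>\<rho> y - \<rho> x\<bar> / (\<rho> x * \<rho> y) \<le> mean_bound * e2 / (rho_low * rho_low)"
        using rho_low(1) rho_low(2)[OF y] rho_low(2)[OF x] rho_diff mean_bound_pos e2 T(1)
          mass_average_le[OF x T(1), of ?G]
        by (intro frac_le mult_mono mult_pos_pos) auto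
    qed
    also have "\<dots> = e"
      unfolding e1_def e2_def using rho_low(1) mean_bound_pos by (simp add: field_simps)
    finally show "\<bar>rel_mass ?G T y - rel_mass ?G T x\<bar> < e" .
  qed
qed

section \<open>Asymptotic constancy of the relative mass\<close>

lemma indicator_stake_measurable [measurable]:
  "(indicator {z. stake j z \<in> W} :: 'e stream \<Rightarrow> ennreal) \<in> borel_measurable m"
  unfolding borel_m by (intro measurable_restrict_space1 borel_measurable_indicator) measurable

lemma nn_mass_measurable [measurable]: "nn_mass {z. stake j z \<in> W} T \<in> borel_measurable m"
  unfolding nn_mass_def orbit_sum_def by (intro word_sum_measurable) measurable

lemma mass_measurable [measurable]: "mass {z. stake j z \<in> W} T \<in> borel_measurable m"
  unfolding mass_def[abs_def] by measurable

text \<open>The renewal equation, with the shortened time \<open>T + \<psi>\<close> estimated by \<open>T\<close>: the mass is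
  subharmonic up to the contribution of the empty word.\<close>

lemma nn_mass_le_transfer: "nn_mass G T x \<le> 1 + L (nn_mass G T) x"
proof -
  have "L (\<lambda>y. orbit_sum (indicator G) (\<lambda>s. indicator {..T} (s - \<psi> y)) y) x \<le> L (nn_mass G T) x"
    unfolding nn_mass_def
  proof (intro nn_transfer_mono orbit_sum_mono)
    fix a s assume "a ## x \<in> X"
    then show "indicator {..T} (s - \<psi> (a ## x)) \<le> (indicator {..T} s :: ennreal)"
      using psi_le[of "a ## x"] c_pos by (auto simp: indicator_def)
  qed auto
  moreover have "indicator X x * indicator {..T} 0 * indicator G x \<le> (1 :: ennreal)"
    by (auto simp: indicator_def)
  ultimately show ?thesis
    unfolding nn_mass_def by (subst orbit_sum_renewal) (rule add_mono)
qed

text \<open>Let \<open>P\<close> be the Markov operator obtained from \<open>L\<close> by normalising with \<open>\<rho>\<close>, for which \<open>\<mu> = \<rho>m\<close> is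
  invariant. Summing the square over the preimages of \<open>x\<close> gives
  \<open>\<integral>(f - f \<circ> \<sigma>)\<^sup>2 d\<mu> = \<integral>P(f\<^sup>2) - 2 f P f + f\<^sup>2 d\<mu> = 2 \<integral>f (f - P f) d\<mu>\<close>, and the
  assumption is \<open>\<rho> (f - P f) \<le> 1\<close>. The computation is written without subtraction because it takes place in the
  extended nonnegative reals.\<close>

lemma dirichlet_form_le:
  fixes f :: "'e stream \<Rightarrow> real"
  assumes [measurable]: "f \<in> borel_measurable m"
    and f: "\<And>x. x \<in> X \<Longrightarrow> 0 \<le> f x" "\<And>x. x \<in> X \<Longrightarrow> f x \<le> b"
    and sub: "\<And>x. x \<in> X \<Longrightarrow> ennreal (\<rho> x * f x) \<le> 1 + L (\<lambda>y. ennreal (\<rho> y * f y)) x"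
  shows "(\<integral>\<^sup>+x. ennreal (\<rho> x * (f x - f (sdrop 1 x))\<^sup>2) \<partial>m) \<le> ennreal (2 * b)"
proof -
  note [measurable] = borel_measurable_drop[OF assms(1), of 1]
  define q where "q x = ennreal (\<rho> x * (f x - f (sdrop 1 x))\<^sup>2)" for x
  define E where "E x = ennreal (\<rho> x * (f x)\<^sup>2)" for x
  have [measurable]: "q \<in> borel_measurable m" "E \<in> borel_measurable m"
    unfolding q_def[abs_def] E_def[abs_def] by measurable
  have pointwise: "L q x + E x \<le> L E x + ennreal (2 * f x)" if x: "x \<in> X" for x
  proof -
    have "L q x + ennreal (2 * f x) * L (\<lambda>y. ennreal (\<rho> y * f y)) x
        = L E x + ennreal ((f x)\<^sup>2) * L (\<lambda>y. ennreal (\<rho> y)) x"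
      unfolding nn_transfer_cmult[symmetric] nn_transfer_add[symmetric]
    proof (rule nn_transfer_cong)
      fix a assume y: "a ## x \<in> X"
      let ?y = "a ## x"
      have fx: "0 \<le> f x" and fy: "0 \<le> f ?y" and r: "0 \<le> \<rho> ?y"
        using f(1) x y rho_pos[OF y] by auto
      have "\<rho> ?y * (f ?y - f x)\<^sup>2 + 2 * f x * (\<rho> ?y * f ?y) =
          \<rho> ?y * (f ?y)\<^sup>2 + (f x)\<^sup>2 * \<rho> ?y"
        by (simp add: power2_eq_square algebra_simps)
      then show "q ?y + ennreal (2 * f x) * ennreal (\<rho> ?y * f ?y) = E ?y + ennreal ((f x)\<^sup>2) * ennreal (\<rho> ?y)"
        unfolding q_def E_def using fx fy r
        by (simp add: ennreal_mult[symmetric] ennreal_plus[symmetric] del: ennreal_plus)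
    qed
    then have identity: "L q x + ennreal (2 * f x) * L (\<lambda>y. ennreal (\<rho> y * f y)) x = L E x + E x"
      using rho_fixed[OF x] rho_pos[OF x] by (simp add: E_def ennreal_mult mult.commute)
    have "E x + E x = ennreal (2 * f x) * ennreal (\<rho> x * f x)"
      unfolding E_def using f(1)[OF x] rho_pos[OF x]
      by (simp add: ennreal_mult[symmetric] ennreal_plus[symmetric] power2_eq_square del: ennreal_plus)
    also have "\<dots> \<le> ennreal (2 * f x) * (1 + L (\<lambda>y. ennreal (\<rho> y * f y)) x)"
      by (intro mult_left_mono sub x) simp
    finally have "L q x + (E x + E x) \<le>
        L q x + ennreal (2 * f x) * (1 + L (\<lambda>y. ennreal (\<rho> y * f y)) x)"
      by (rule add_left_mono)
    also have "\<dots> = L E x + E x + ennreal (2 * f x)"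
      unfolding identity[symmetric] by (simp add: distrib_left add_ac)
    finally have "E x + (L q x + E x) \<le> E x + (L E x + ennreal (2 * f x))"
      by (simp add: add_ac)
    then show ?thesis
      by (simp add: ennreal_add_left_cancel_le E_def)
  qed
  have E_fin: "(\<integral>\<^sup>+x. E x \<partial>m) \<noteq> \<infinity>"
  proof -
    have "(\<integral>\<^sup>+x. E x \<partial>m) \<le> (\<integral>\<^sup>+x. ennreal (R * b\<^sup>2) \<partial>m)"
      unfolding E_def using f rho_pos rho_le R_pos
      by (intro nn_integral_mono ennreal_leI mult_mono power_mono)
        (auto simp: space_m intro: less_imp_le order_trans)
    also have "\<dots> < \<infinity>" by (simp add: emeasure_space_1 ennreal_mult_less_top)
    finally show ?thesis by simp
  qed
  have "(\<integral>\<^sup>+x. q x \<partial>m) + (\<integral>\<^sup>+x. E x \<partial>m) = (\<integral>\<^sup>+x. L q x + E x \<partial>m)"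
    by (simp add: nn_integral_add nn_integral_nn_transfer)
  also have "\<dots> \<le> (\<integral>\<^sup>+x. L E x + ennreal (2 * b) \<partial>m)"
    using f(2) by (intro nn_integral_mono order_trans[OF pointwise] add_left_mono ennreal_leI) (auto simp: space_m)
  also have "\<dots> = (\<integral>\<^sup>+x. E x \<partial>m) + ennreal (2 * b)"
    by (simp add: nn_integral_add nn_integral_nn_transfer emeasure_space_1)
  finally have "(\<integral>\<^sup>+x. E x \<partial>m) + (\<integral>\<^sup>+x. q x \<partial>m) \<le> (\<integral>\<^sup>+x. E x \<partial>m) + ennreal (2 * b)"
    by (simp add: add.commute)
  then show ?thesis
    using E_fin by (simp add: ennreal_add_left_cancel_le q_def)
qed

lemma rel_mass_nonneg: "x \<in> X \<Longrightarrow> 0 \<le> T \<Longrightarrow> 0 \<le> rel_mass G T x"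
  using rho_pos[of x] by (simp add: rel_mass_def)

lemma rel_mass_le:
  assumes "x \<in> X" "1 \<le> T"
  shows "rel_mass G T x \<le> mean_bound / rho_low"
  unfolding rel_mass_def using assms rho_low(1) rho_low(2)[OF assms(1)] mean_bound_pos mass_average_le[OF assms]
  by (intro frac_le) auto

lemma rel_mass_measurable [measurable]: "rel_mass {z. stake j z \<in> W} T \<in> borel_measurable m"
  unfolding rel_mass_def[abs_def] by measurable

lemma rel_mass_dirichlet_form_le:
  assumes "1 \<le> T" and G: "G = {z. stake j z \<in> W}"
  shows "(\<integral>\<^sup>+x. ennreal (\<rho> x * (rel_mass G T x - rel_mass G T (sdrop 1 x))\<^sup>2) \<partial>m) \<le> ennreal (2 * mean_bound / rho_low / T)"
proof -
  have [measurable]: "rel_mass G T \<in> borel_measurable m" unfolding G by measurable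
  note [measurable] = borel_measurable_drop[OF \<open>rel_mass G T \<in> borel_measurable m\<close>, of 1]
  have mass_eq: "\<rho> x * (T * rel_mass G T x) = mass G T x" if "x \<in> X" for x
    using rho_pos[OF that] \<open>1 \<le> T\<close> by (simp add: rel_mass_def)
  have "(\<integral>\<^sup>+x. ennreal (\<rho> x * (T * rel_mass G T x - T * rel_mass G T (sdrop 1 x))\<^sup>2) \<partial>m) \<le> ennreal (2 * (T * (mean_bound / rho_low)))"
  proof (rule dirichlet_form_le)
    show "(\<lambda>x. T * rel_mass G T x) \<in> borel_measurable m" by measurable
    fix x assume x: "x \<in> X"
    show "0 \<le> T * rel_mass G T x" "T * rel_mass G T x \<le> T * (mean_bound / rho_low)"
      using rel_mass_nonneg[OF x, of T G] \<open>1 \<le> T\<close> mult_left_mono[OF rel_mass_le[OF x \<open>1 \<le> T\<close>, of G], of T] by auto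
    have "L (nn_mass G T) x = L (\<lambda>y. ennreal (\<rho> y * (T * rel_mass G T y))) x"
      by (intro nn_transfer_cong) (simp add: mass_eq ennreal_mass)
    then show "ennreal (\<rho> x * (T * rel_mass G T x)) \<le> 1 + L (\<lambda>y. ennreal (\<rho> y * (T * rel_mass G T y))) x"
      using nn_mass_le_transfer[of G T x] x by (simp add: mass_eq ennreal_mass)
  qed
  also have "(\<integral>\<^sup>+x. ennreal (\<rho> x * (T * rel_mass G T x - T * rel_mass G T (sdrop 1 x))\<^sup>2) \<partial>m) =
      (\<integral>\<^sup>+x. ennreal (T\<^sup>2) * ennreal (\<rho> x * (rel_mass G T x - rel_mass G T (sdrop 1 x))\<^sup>2) \<partial>m)"
    by (intro nn_integral_cong)
      (simp add: ennreal_mult'[symmetric] right_diff_distrib[symmetric] power_mult_distrib mult_ac)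
  also have "\<dots> = ennreal (T\<^sup>2) * (\<integral>\<^sup>+x. ennreal (\<rho> x * (rel_mass G T x - rel_mass G T (sdrop 1 x))\<^sup>2) \<partial>m)"
    by (rule nn_integral_cmult) measurable
  finally have "ennreal (1 / T\<^sup>2) * (ennreal (T\<^sup>2) * (\<integral>\<^sup>+x. ennreal (\<rho> x * (rel_mass G T x - rel_mass G T (sdrop 1 x))\<^sup>2) \<partial>m))
      \<le> ennreal (1 / T\<^sup>2) * ennreal (2 * (T * (mean_bound / rho_low)))"
    by (rule mult_left_mono) simp
  moreover have "ennreal (1 / T\<^sup>2) * ennreal (T\<^sup>2) = 1"
    using \<open>1 \<le> T\<close> by (subst ennreal_mult[symmetric]) auto
  moreover have "ennreal (1 / T\<^sup>2) * ennreal (2 * (T * (mean_bound / rho_low))) = ennreal (1 / T\<^sup>2 * (2 * (T * (mean_bound / rho_low))))"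
    using \<open>1 \<le> T\<close> rho_low(1) mean_bound_pos by (subst ennreal_mult) auto
  moreover have "1 / T\<^sup>2 * (2 * (T * (mean_bound / rho_low))) = 2 * mean_bound / rho_low / T"
    using \<open>1 \<le> T\<close> by (simp add: power2_eq_square)
  ultimately show ?thesis
    by (simp only: mult.assoc[symmetric] mult_1)
qed

text \<open>If the difference were at least \<open>e\<close> at a late time, then by asymptotic continuity it would be at
  least \<open>e/3\<close> on a whole cylinder chosen independently of the time. This cylinder has positive measure, which
  contradicts the decay of the energy.\<close>

lemma rel_mass_shift_asymptotic:
  assumes y: "y \<in> X" and G: "G = {z. stake j z \<in> W}"
  shows "((\<lambda>T. rel_mass G T y - rel_mass G T (sdrop 1 y)) \<longlongrightarrow> 0) at_top"
proof (rule tendstoI)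
  fix e :: real assume "0 < e"
  then have "0 < e / 3" by simp
  have sy: "sdrop 1 y \<in> X" using y by (rule sdrop_in_shift_space)
  obtain k1 T1 where 1: "\<forall>z\<in>X. \<forall>T\<ge>T1. stake k1 z = stake k1 y \<longrightarrow> \<bar>rel_mass G T z - rel_mass G T y\<bar> < e / 3"
    using rel_mass_asymptotically_continuous[OF y \<open>0 < e / 3\<close>] unfolding G by blast
  obtain k2 T2 where 2: "\<forall>z\<in>X. \<forall>T\<ge>T2. stake k2 z = stake k2 (sdrop 1 y) \<longrightarrow>
      \<bar>rel_mass G T z - rel_mass G T (sdrop 1 y)\<bar> < e / 3"
    using rel_mass_asymptotically_continuous[OF sy \<open>0 < e / 3\<close>] unfolding G by blast
  \<comment> \<open>One letter more, because the shift drops one.\<close>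
  define k where "k = Suc (max k1 k2)"
  let ?C = "{z \<in> X. stake k z = stake k y}"
  have C [measurable]: "?C \<in> sets m" using cylinder_sets[of k "{stake k y}"] by simp
  have "0 < emeasure m ?C"
    using cylinder_pos[OF y, of k] by (simp add: k_def)
  then have mC: "0 < measure m ?C"
    by (simp add: emeasure_eq_measure)
  define \<delta> where "\<delta> = rho_low * (e / 3)\<^sup>2 * measure m ?C"
  have \<delta>: "0 < \<delta>"
    unfolding \<delta>_def using rho_low(1) \<open>0 < e\<close> mC by simp
  have small: "\<bar>rel_mass G T y - rel_mass G T (sdrop 1 y)\<bar> < e"
    if T: "T1 \<le> T" "T2 \<le> T" "1 \<le> T" "2 * mean_bound / rho_low / \<delta> < T" for T
  proof (rule ccontr)
    assume large: "\<not> \<bar>rel_mass G T y - rel_mass G T (sdrop 1 y)\<bar> < e"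
    have "ennreal \<delta> = (\<integral>\<^sup>+z. ennreal (rho_low * (e / 3)\<^sup>2) * indicator ?C z \<partial>m)"
      using rho_low(1) by (simp add: nn_integral_cmult_indicator \<delta>_def emeasure_eq_measure ennreal_mult)
    also have "\<dots> \<le> (\<integral>\<^sup>+z. ennreal (\<rho> z * (rel_mass G T z - rel_mass G T (sdrop 1 z))\<^sup>2) \<partial>m)"
    proof (intro nn_integral_mono)
      fix z
      show "ennreal (rho_low * (e / 3)\<^sup>2) * indicator ?C z \<le> ennreal (\<rho> z * (rel_mass G T z - rel_mass G T (sdrop 1 z))\<^sup>2)"
      proof (cases "z \<in> ?C")
        case True
        then have z: "z \<in> X" "stake k z = stake k y" by auto
        have "stake k1 z = stake k1 y"
          using z(2) by (rule stake_eq_mono) (simp add: k_def)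
        then have "\<bar>rel_mass G T z - rel_mass G T y\<bar> < e / 3"
          using 1 z(1) T(1) by blast
        moreover have "1 + i < k" if "i < k2" for i
          using that by (simp add: k_def)
        then have "stake k2 (sdrop 1 z) = stake k2 (sdrop 1 y)"
          using z(2) unfolding stake_eq_iff sdrop_snth by blast
        then have "\<bar>rel_mass G T (sdrop 1 z) - rel_mass G T (sdrop 1 y)\<bar> < e / 3"
          using 2 sdrop_in_shift_space[OF z(1)] T(2) by blast
        ultimately have "e / 3 \<le> \<bar>rel_mass G T z - rel_mass G T (sdrop 1 z)\<bar>"
          using large by linarith
        then have "(e / 3)\<^sup>2 \<le> \<bar>rel_mass G T z - rel_mass G T (sdrop 1 z)\<bar>\<^sup>2"
          using \<open>0 < e\<close> by (intro power_mono) auto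
        then have "rho_low * (e / 3)\<^sup>2 \<le> \<rho> z * (rel_mass G T z - rel_mass G T (sdrop 1 z))\<^sup>2"
          using rho_low(1) rho_low(2)[OF z(1)] by (intro mult_mono) auto
        then show ?thesis using True by (simp add: ennreal_leI)
      qed simp
    qed
    also have "\<dots> \<le> ennreal (2 * mean_bound / rho_low / T)"
      by (rule rel_mass_dirichlet_form_le[OF T(3) G])
    finally have "\<delta> \<le> 2 * mean_bound / rho_low / T"
      using T(3) mean_bound_pos rho_low(1) by (simp add: ennreal_le_iff)
    moreover have "2 * mean_bound / rho_low / T < \<delta>"
    proof -
      have "2 * mean_bound / rho_low < T * \<delta>"
        using T(4) \<delta> by (simp only: pos_divide_less_eq)
      moreover have "0 < T" using T(3) by simp
      ultimately show ?thesis
        by (simp only: pos_divide_less_eq mult.commute)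
    qed
    ultimately show False by simp
  qed
  show "\<forall>\<^sub>F T in at_top. dist (rel_mass G T y - rel_mass G T (sdrop 1 y)) 0 < e"
    using eventually_ge_at_top[of T1] eventually_ge_at_top[of T2] eventually_ge_at_top[of 1]
      eventually_gt_at_top[of "2 * mean_bound / rho_low / \<delta>"]
    by eventually_elim (use small in auto)
qed

lemma rel_mass_word_asymptotic:
  assumes G: "G = {z. stake j z \<in> W}"
  shows "w @- y \<in> X \<Longrightarrow> ((\<lambda>T. rel_mass G T (w @- y) - rel_mass G T y) \<longlongrightarrow> 0) at_top"
proof (induction w)
  case (Cons a w)
  have "w @- y \<in> X" using Cons.prems by (simp add: Cons_in_shift_space)
  from tendsto_add[OF rel_mass_shift_asymptotic[OF Cons.prems G] Cons.IH[OF this]]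
  show ?case by simp
qed simp

text \<open>A long prefix of \<open>x\<close> and a connecting word lead from \<open>y\<close> to a point close to \<open>x\<close>. Prefixing letters does
  not matter in the limit, and neither does moving within a small cylinder.\<close>

lemma rel_mass_asymptotically_constant:
  assumes x: "x \<in> X" and y: "y \<in> X" and G: "G = {z. stake j z \<in> W}"
  shows "((\<lambda>T. rel_mass G T y - rel_mass G T x) \<longlongrightarrow> 0) at_top"
proof (rule tendstoI)
  fix e :: real assume "0 < e"
  then have "0 < e / 2" by simp
  obtain k T0 where near: "\<forall>z\<in>X. \<forall>T\<ge>T0. stake k z = stake k x \<longrightarrow> \<bar>rel_mass G T z - rel_mass G T x\<bar> < e / 2"
    using rel_mass_asymptotically_continuous[OF x \<open>0 < e / 2\<close>] unfolding G by blast
  obtain \<tau> where \<tau>: "(stake (Suc k) x @ \<tau>) @- y \<in> X"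
    using finitely_primitive_bridge[OF primitive] x y by (metis zero_less_Suc)
  let ?z = "(stake (Suc k) x @ \<tau>) @- y"
  have "stake (Suc k) ?z = stake (Suc k) x"
    by (simp add: stake_shift del: stake.simps)
  then have "stake k ?z = stake k x"
    by (rule stake_eq_mono) simp
  then have near_z: "\<bar>rel_mass G T ?z - rel_mass G T x\<bar> < e / 2" if "T0 \<le> T" for T
    using near \<tau> that by blast
  have "\<forall>\<^sub>F T in at_top. dist (rel_mass G T ?z - rel_mass G T y) 0 < e / 2"
    using rel_mass_word_asymptotic[OF G \<tau>] \<open>0 < e / 2\<close> by (rule tendstoD)
  with eventually_ge_at_top[of T0]
  show "\<forall>\<^sub>F T in at_top. dist (rel_mass G T y - rel_mass G T x) 0 < e"
  proof eventually_elim
    case (elim T)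
    have "\<bar>rel_mass G T ?z - rel_mass G T y\<bar> < e / 2"
      using elim(2) unfolding dist_real_def by simp
    with near_z[OF elim(1)] have "\<bar>rel_mass G T y - rel_mass G T x\<bar> < e / 2 + e / 2"
      by linarith
    then show ?case by (simp add: dist_real_def)
  qed
qed

section \<open>The value of the limit\<close>

text \<open>The difference \<open>Y\<^sub>T x - Y\<^bsub>T + \<psi> x\<^esub> x\<close>, where \<open>Y\<^sub>T\<close> is the orbit sum with kernel \<open>(T - s)\<^sup>+\<close>: the
  conversion to the extended nonnegative reals truncates at \<open>0\<close>, and \<open>min (T - s) (- \<psi> x)\<close> is the difference of
  the two truncated kernels.\<close>

definition excursion :: "'e stream set \<Rightarrow> real \<Rightarrow> 'e stream \<Rightarrow> ennreal" where
  "excursion G T x = orbit_sum (indicator G) (\<lambda>s. ennreal (min (T - s) (- \<psi> x))) x"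

lemma excursion_le: "x \<in> X \<Longrightarrow> excursion G T x \<le> ennreal (- \<psi> x * mass G T x)"
proof -
  assume x: "x \<in> X"
  have "0 \<le> - \<psi> x" using psi_le[OF x] c_pos by simp
  have "excursion G T x \<le> orbit_sum (indicator G) (\<lambda>s. ennreal (- \<psi> x) * indicator {..T} s) x"
    unfolding excursion_def
    by (intro orbit_sum_mono) (auto simp: indicator_def ennreal_leI ennreal_neg min.coboundedI1)
  also have "\<dots> = ennreal (- \<psi> x) * nn_mass G T x"
    unfolding orbit_sum_cmult nn_mass_def ..
  also have "\<dots> = ennreal (- \<psi> x * mass G T x)"
    using \<open>0 \<le> - \<psi> x\<close> by (subst ennreal_mult) (simp_all add: ennreal_mass x)
  finally show ?thesis .
qed

lemma excursion_ge: "x \<in> X \<Longrightarrow> ennreal (- \<psi> x * mass G (T + \<psi> x) x) \<le> excursion G T x"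
proof -
  assume x: "x \<in> X"
  have "0 \<le> - \<psi> x" using psi_le[OF x] c_pos by simp
  then have "ennreal (- \<psi> x * mass G (T + \<psi> x) x) = ennreal (- \<psi> x) * nn_mass G (T + \<psi> x) x"
    by (subst ennreal_mult) (simp_all add: ennreal_mass x)
  also have "\<dots> = orbit_sum (indicator G) (\<lambda>s. ennreal (- \<psi> x) * indicator {..T + \<psi> x} s) x"
    unfolding orbit_sum_cmult nn_mass_def ..
  also have "\<dots> \<le> excursion G T x"
    unfolding excursion_def by (intro orbit_sum_mono) (auto simp: indicator_def)
  finally show ?thesis .
qed

lemma excursion_measurable [measurable]:
  "excursion {z. stake j z \<in> W} T \<in> borel_measurable m"
proof -
  let ?G = "{z. stake j z \<in> W}"
  note [measurable] = borel_measurable_drop[OF psi_measurable]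
  have "excursion ?G T = word_sum (\<lambda>n y. ennreal (exp (- S n y)) *
      ennreal (min (T - S n y) (- \<psi> (sdrop n y))) * indicator ?G y)"
    unfolding excursion_def orbit_sum_def
    by (intro ext word_sum_cong) (simp add: sdrop_shift)
  also have "\<dots> \<in> borel_measurable m"
    by (intro word_sum_measurable) measurable
  finally show ?thesis .
qed

text \<open>With \<open>f x = Y\<^bsub>T + \<psi> x\<^esub> x\<close>, the renewal equation for \<open>Y\<^sub>T\<close> reads \<open>f + excursion = T 1\<^sub>G + L f\<close>. Since
  \<open>f\<close> and \<open>L f\<close> have the same finite integral, they cancel.\<close>

lemma nn_integral_excursion:
  assumes "0 \<le> T" and G: "G = {z. stake j z \<in> W}"
  shows "(\<integral>\<^sup>+x. excursion G T x \<partial>m) = ennreal T * emeasure m (X \<inter> G)"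
proof -
  define f where "f x = orbit_sum (indicator G) (\<lambda>s. ennreal (T + \<psi> x - s)) x" for x
  have f_meas [measurable]: "f \<in> borel_measurable m"
  proof -
    note [measurable] = borel_measurable_drop[OF psi_measurable]
    have "f = word_sum (\<lambda>n y. ennreal (exp (- S n y)) *
        ennreal (T + \<psi> (sdrop n y) - S n y) * indicator G y)"
      unfolding f_def orbit_sum_def by (intro ext word_sum_cong) (simp add: sdrop_shift)
    also have "\<dots> \<in> borel_measurable m"
      unfolding G by (intro word_sum_measurable) measurable
    finally show ?thesis .
  qed
  have [measurable]: "X \<inter> G \<in> sets m"
    using cylinder_sets[of j W] by (simp add: G Collect_conj_eq)
  have [measurable]: "excursion G T \<in> borel_measurable m"
    unfolding G by measurable
  have renewal: "f x + excursion G T x = ennreal T * indicator (X \<inter> G) x + L f x" if x: "x \<in> X" for x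
  proof -
    have "(\<lambda>s. ennreal (T + \<psi> x - s) + ennreal (min (T - s) (- \<psi> x))) = (\<lambda>s. ennreal (T - s))"
    proof
      fix s
      have "\<psi> x \<le> 0" using psi_le[OF x] c_pos by simp
      then show "ennreal (T + \<psi> x - s) + ennreal (min (T - s) (- \<psi> x)) = ennreal (T - s)"
        by (cases "0 \<le> T + \<psi> x - s"; cases "0 \<le> T - s")
          (auto simp: ennreal_plus[symmetric] min_def ennreal_neg simp del: ennreal_plus)
    qed
    then have "f x + excursion G T x = orbit_sum (indicator G) (\<lambda>s. ennreal (T - s)) x"
      unfolding f_def excursion_def orbit_sum_add[symmetric] by simp
    also have "\<dots> = ennreal T * indicator (X \<inter> G) x + L f x"
      using x by (subst orbit_sum_renewal) (simp add: f_def[abs_def] algebra_simps indicator_def)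
    finally show ?thesis .
  qed
  have f_fin: "(\<integral>\<^sup>+x. f x \<partial>m) \<noteq> \<infinity>"
  proof -
    have "f x \<le> ennreal (T * (window_bound * (T / c + 2)))" if x: "x \<in> X" for x
    proof -
      have "f x \<le> orbit_sum (indicator G) (\<lambda>s. ennreal T * indicator {..T} s) x"
        unfolding f_def using psi_le[OF x] c_pos
        by (intro orbit_sum_mono) (auto simp: indicator_def ennreal_leI ennreal_neg)
      also have "\<dots> \<le> ennreal T * ennreal (window_bound * (T / c + 2))"
        unfolding orbit_sum_cmult using nn_mass_bound[OF x \<open>0 \<le> T\<close>, of G]
        by (intro mult_left_mono) (auto simp: nn_mass_def)
      finally show ?thesis
        using \<open>0 \<le> T\<close> window_bound_pos c_pos by (simp add: ennreal_mult[symmetric])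
    qed
    then have "(\<integral>\<^sup>+x. f x \<partial>m) \<le> (\<integral>\<^sup>+x. ennreal (T * (window_bound * (T / c + 2))) \<partial>m)"
      by (intro nn_integral_mono) (simp add: space_m)
    also have "\<dots> < \<infinity>" by (simp add: emeasure_space_1)
    finally show ?thesis by simp
  qed
  have "(\<integral>\<^sup>+x. f x \<partial>m) + (\<integral>\<^sup>+x. excursion G T x \<partial>m) = (\<integral>\<^sup>+x. f x + excursion G T x \<partial>m)"
    by (simp add: nn_integral_add)
  also have "\<dots> = (\<integral>\<^sup>+x. ennreal T * indicator (X \<inter> G) x + L f x \<partial>m)"
    by (intro nn_integral_cong renewal) (simp add: space_m)
  also have "\<dots> = (\<integral>\<^sup>+x. f x \<partial>m) + ennreal T * emeasure m (X \<inter> G)"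
    by (simp add: nn_integral_add nn_integral_nn_transfer nn_integral_cmult_indicator add.commute)
  finally show ?thesis
    using f_fin by (simp add: ennreal_add_left_cancel)
qed

text \<open>The mean time taken by one step, with respect to the equilibrium state.\<close>

definition drift :: real where "drift = (\<integral>x. - \<psi> x * \<rho> x \<partial>m)"

text \<open>Integrability for \<open>\<rho>m\<close> passes to \<open>m\<close> because \<open>\<rho>\<close> is bounded below.\<close>

lemma integrable_psi: "integrable m \<psi>"
proof (rule Bochner_Integration.integrable_bound)
  show "integrable m (\<lambda>x. (1 / rho_low) * (\<psi> x * \<rho> x))"
    using integrable_psi_rho by simp
  show "AE x in m. norm (\<psi> x) \<le> norm ((1 / rho_low) * (\<psi> x * \<rho> x))"
  proof (rule AE_I2)
    fix x assume "x \<in> space m"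
    then have "1 \<le> \<rho> x / rho_low"
      using rho_low by (simp add: space_m)
    then have "\<bar>\<psi> x\<bar> * 1 \<le> \<bar>\<psi> x\<bar> * (\<rho> x / rho_low)"
      by (rule mult_left_mono) simp
    then show "norm (\<psi> x) \<le> norm ((1 / rho_low) * (\<psi> x * \<rho> x))"
      using rho_low(1) \<open>x \<in> space m\<close> rho_pos by (simp add: abs_mult space_m less_imp_le)
  qed
qed measurable

lemma drift_pos: "0 < drift"
proof -
  have "(\<integral>x. c * rho_low \<partial>m) \<le> drift"
    unfolding drift_def
  proof (rule integral_mono)
    show "integrable m (\<lambda>x. - \<psi> x * \<rho> x)"
      using integrable_psi_rho by simp
    fix x assume "x \<in> space m"
    then show "c * rho_low \<le> - \<psi> x * \<rho> x"
      using psi_le[of x] rho_low c_pos by (intro mult_mono) (auto simp: space_m)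
  qed simp
  then show ?thesis
    using c_pos rho_low(1) by (simp add: prob_space) (meson less_le_trans mult_pos_pos)
qed

text \<open>By the bounds for the excursion, its average over \<open>T\<close> is asymptotically \<open>-\<psi> \<rho>\<close> times the relative mass, in
  which \<open>x\<close> can be replaced by \<open>\<xi>\<close>. The difference \<open>h\<close> is dominated by a multiple of \<open>\<bar>\<psi>\<bar> + \<bar>\<psi>\<bar>\<rho>\<close>.\<close>

lemma rel_mass_tendsto:
  assumes \<xi>: "\<xi> \<in> X" and G: "G = {z. stake j z \<in> W}"
  shows "((\<lambda>T. rel_mass G T \<xi>) \<longlongrightarrow> measure m (X \<inter> G) / drift) at_top"
proof -
  define d where "d T x = enn2real (excursion G T x)" for T x
  define h where "h T x = d T x / T - - \<psi> x * \<rho> x * rel_mass G T \<xi>" for T x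
  have [measurable]: "excursion G T \<in> borel_measurable m" for T
    unfolding G by measurable
  have d_meas [measurable]: "d T \<in> borel_measurable m" for T
    unfolding d_def[abs_def] by measurable
  have psi_nonneg: "0 \<le> - \<psi> x" if "x \<in> X" for x
    using psi_le[OF that] c_pos by simp
  have ennreal_d: "ennreal (d T x) = excursion G T x" if "x \<in> X" for T x
    unfolding d_def using excursion_le[OF that, of G T]
    by (intro ennreal_enn2real) (auto simp: top_unique le_less_trans)
  have d_nonneg: "0 \<le> d T x" for T x by (simp add: d_def)
  have d_le: "d T x \<le> - \<psi> x * mass G T x" if x: "x \<in> X" for T x
    using excursion_le[OF x, of G T] mult_nonneg_nonneg[OF psi_nonneg[OF x] mass_nonneg, of G T]
    unfolding ennreal_d[OF x, symmetric] by (simp only: ennreal_le_iff)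
  have d_ge: "- \<psi> x * (mass G T x - window_bound * (- \<psi> x / c + 1)) \<le> d T x" if x: "x \<in> X" for T x
  proof -
    have "- \<psi> x * (mass G T x - window_bound * (- \<psi> x / c + 1)) \<le> - \<psi> x * mass G (T + \<psi> x) x"
      using mass_increment[OF x psi_nonneg[OF x], of G "T + \<psi> x"] psi_nonneg[OF x]
      by (intro mult_left_mono) auto
    also have "\<dots> \<le> d T x"
      using excursion_ge[OF x, of G T] d_nonneg[of T x]
      unfolding ennreal_d[OF x, symmetric] by (simp only: ennreal_le_iff)
    finally show ?thesis .
  qed
  have int_psi: "integrable m (\<lambda>x. - \<psi> x)" using integrable_psi by simp
  have int_psi_rho: "integrable m (\<lambda>x. - \<psi> x * \<rho> x)" using integrable_psi_rho by simp
  have int_d: "(\<integral>x. d T x \<partial>m) = T * measure m (X \<inter> G)" if "0 \<le> T" for T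
  proof -
    have "(\<integral>x. d T x \<partial>m) = enn2real (\<integral>\<^sup>+x. ennreal (d T x) \<partial>m)"
      by (rule integral_eq_nn_integral) (auto simp: d_nonneg)
    also have "(\<integral>\<^sup>+x. ennreal (d T x) \<partial>m) = (\<integral>\<^sup>+x. excursion G T x \<partial>m)"
      by (intro nn_integral_cong) (simp add: ennreal_d space_m)
    finally show ?thesis
      using that unfolding nn_integral_excursion[OF that G] emeasure_eq_measure by (simp add: enn2real_mult)
  qed
  have d_bound: "d T x / T \<le> - \<psi> x * mean_bound" if "x \<in> X" "1 \<le> T" for T x
  proof -
    have "d T x / T \<le> - \<psi> x * mass G T x / T"
      using d_le[OF that(1)] that(2) by (intro divide_right_mono) auto
    also have "\<dots> = - \<psi> x * (mass G T x / T)" by simp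
    also have "\<dots> \<le> - \<psi> x * mean_bound"
      using psi_nonneg[OF that(1)] mass_average_le[OF that] by (intro mult_left_mono) auto
    finally show ?thesis .
  qed
  have int_d_T: "integrable m (d T)" if "1 \<le> T" for T
  proof (rule Bochner_Integration.integrable_bound)
    show "integrable m (\<lambda>x. T * (- \<psi> x * mean_bound))" using int_psi by simp
    show "AE x in m. norm (d T x) \<le> norm (T * (- \<psi> x * mean_bound))"
    proof (rule AE_I2)
      fix x assume "x \<in> space m"
      then have "d T x / T \<le> - \<psi> x * mean_bound"
        using d_bound that by (simp add: space_m)
      then have "d T x \<le> T * (- \<psi> x * mean_bound)"
        using that by (simp add: field_simps)
      then show "norm (d T x) \<le> norm (T * (- \<psi> x * mean_bound))"
        using d_nonneg[of T x] by simp
    qed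
  qed measurable
  have "((\<lambda>T. \<integral>x. h T x \<partial>m) \<longlongrightarrow> (\<integral>x. 0 \<partial>m)) at_top"
  proof (rule integral_dominated_convergence_at_top)
    show "integrable m (\<lambda>x. - \<psi> x * mean_bound + - \<psi> x * \<rho> x * (mean_bound / rho_low))"
      using int_psi int_psi_rho by (intro Bochner_Integration.integrable_add integrable_mult_left) auto
    show "h T \<in> borel_measurable m" for T unfolding h_def[abs_def] by measurable
    show "\<forall>\<^sub>F T in at_top. AE x in m. norm (h T x) \<le> - \<psi> x * mean_bound + - \<psi> x * \<rho> x * (mean_bound / rho_low)"
      using eventually_ge_at_top[of 1]
    proof eventually_elim
      case (elim T)
      show ?case
      proof (rule AE_I2)
        fix x assume "x \<in> space m"
        then have x: "x \<in> X" by (simp add: space_m)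
        have pr: "0 \<le> - \<psi> x * \<rho> x"
          using psi_nonneg[OF x] rho_pos[OF x] by (intro mult_nonneg_nonneg) auto
        have "0 \<le> d T x / T" "d T x / T \<le> - \<psi> x * mean_bound"
          using elim d_nonneg d_bound[OF x elim] by auto
        moreover have "0 \<le> - \<psi> x * \<rho> x * rel_mass G T \<xi>"
          using elim by (intro mult_nonneg_nonneg[OF pr] rel_mass_nonneg[OF \<xi>]) auto
        moreover have "- \<psi> x * \<rho> x * rel_mass G T \<xi> \<le> - \<psi> x * \<rho> x * (mean_bound / rho_low)"
          using rel_mass_le[OF \<xi> elim] pr by (intro mult_left_mono) auto
        ultimately show "norm (h T x) \<le> - \<psi> x * mean_bound + - \<psi> x * \<rho> x * (mean_bound / rho_low)"
          unfolding h_def real_norm_def by linarith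
      qed
    qed
    show "AE x in m. ((\<lambda>T. h T x) \<longlongrightarrow> 0) at_top"
    proof (rule AE_I2)
      fix x assume "x \<in> space m"
      then have x: "x \<in> X" by (simp add: space_m)
      let ?k = "- \<psi> x * (window_bound * (- \<psi> x / c + 1))"
      have 1: "((\<lambda>T. d T x / T - - \<psi> x * \<rho> x * rel_mass G T x) \<longlongrightarrow> 0) at_top"
      proof (rule Lim_null_comparison)
        show "((\<lambda>T. ?k / T) \<longlongrightarrow> 0) at_top"
          by (intro tendsto_divide_0[OF tendsto_const] filterlim_at_top_imp_at_infinity filterlim_ident)
        show "\<forall>\<^sub>F T in at_top. norm (d T x / T - - \<psi> x * \<rho> x * rel_mass G T x) \<le> ?k / T"
          using eventually_ge_at_top[of 1]
        proof eventually_elim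
          case (elim T)
          have "- \<psi> x * \<rho> x * rel_mass G T x = - \<psi> x * mass G T x / T"
            using rho_pos[OF x] by (simp add: rel_mass_def)
          moreover have "norm (d T x / T - - \<psi> x * mass G T x / T) \<le> ?k / T"
          proof -
            have "\<bar>d T x - - \<psi> x * mass G T x\<bar> \<le> ?k"
              using d_le[OF x, of T] d_ge[OF x, of T] unfolding right_diff_distrib by linarith
            then have "\<bar>d T x - - \<psi> x * mass G T x\<bar> / T \<le> ?k / T"
              using elim by (intro divide_right_mono) auto
            moreover have "norm (d T x / T - - \<psi> x * mass G T x / T) = \<bar>d T x - - \<psi> x * mass G T x\<bar> / T"
              using elim unfolding diff_divide_distrib[symmetric] real_norm_def abs_divide by simp
            ultimately show ?thesis by simp
          qed
          ultimately show ?case by simp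
        qed
      qed
      have 2: "((\<lambda>T. - \<psi> x * \<rho> x * (rel_mass G T x - rel_mass G T \<xi>)) \<longlongrightarrow> - \<psi> x * \<rho> x * 0) at_top"
        by (intro tendsto_mult tendsto_const rel_mass_asymptotically_constant[OF \<xi> x G])
      from tendsto_add[OF 1 2] show "((\<lambda>T. h T x) \<longlongrightarrow> 0) at_top"
        by (simp add: h_def algebra_simps)
    qed
  qed simp
  moreover have "\<forall>\<^sub>F T in at_top. (\<integral>x. h T x \<partial>m) = measure m (X \<inter> G) - drift * rel_mass G T \<xi>"
    using eventually_ge_at_top[of 1]
  proof eventually_elim
    case (elim T)
    have "(\<integral>x. h T x \<partial>m) = (\<integral>x. d T x / T \<partial>m) - (\<integral>x. - \<psi> x * \<rho> x * rel_mass G T \<xi> \<partial>m)"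
      unfolding h_def using int_d_T[OF elim] int_psi_rho
      by (intro Bochner_Integration.integral_diff integrable_mult_left) auto
    also have "(\<integral>x. d T x / T \<partial>m) = measure m (X \<inter> G)"
      using int_d[of T] elim by simp
    also have "(\<integral>x. - \<psi> x * \<rho> x * rel_mass G T \<xi> \<partial>m) = drift * rel_mass G T \<xi>"
      unfolding drift_def by (rule integral_mult_left_zero)
    finally show ?case .
  qed
  ultimately have "((\<lambda>T. measure m (X \<inter> G) - drift * rel_mass G T \<xi>) \<longlongrightarrow> 0) at_top"
    by (simp add: filterlim_cong[OF refl refl])
  then have "((\<lambda>T. (measure m (X \<inter> G) - (measure m (X \<inter> G) - drift * rel_mass G T \<xi>)) / drift) \<longlongrightarrow>
      (measure m (X \<inter> G) - 0) / drift) at_top"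
    using drift_pos by (intro tendsto_intros) auto
  then show ?thesis
    using drift_pos by simp
qed

section \<open>From cylinder sets to Borel sets, and from mass to counting\<close>

lemma mass_average_tendsto:
  assumes \<xi>: "\<xi> \<in> X" and G: "G = {z. stake j z \<in> W}"
  shows "((\<lambda>T. mass G T \<xi> / T) \<longlongrightarrow> \<rho> \<xi> / drift * measure m (X \<inter> G)) at_top"
proof -
  have "((\<lambda>T. \<rho> \<xi> * rel_mass G T \<xi>) \<longlongrightarrow> \<rho> \<xi> * (measure m (X \<inter> G) / drift)) at_top"
    by (intro tendsto_intros rel_mass_tendsto[OF \<xi> G])
  then show ?thesis
    using rho_pos[OF \<xi>] by (simp add: rel_mass_def)
qed

text \<open>The sets \<open>inner k\<close> increase to the interior of \<open>B\<close> and the sets \<open>outer k\<close> decrease to its closure. Both are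
  determined by the first \<open>k\<close> letters.\<close>

lemma mass_average_tendsto_borel:
  assumes \<xi>: "\<xi> \<in> X" and B: "B \<in> sets m"
    and null: "measure m (word_topology A frontier_of B) = 0"
  shows "((\<lambda>T. mass B T \<xi> / T) \<longlongrightarrow> \<rho> \<xi> / drift * measure m B) at_top"
proof -
  define inner where "inner k = {z. stake k z \<in> {w. \<forall>y\<in>X. stake k y = w \<longrightarrow> y \<in> B}}" for k
  define outer where "outer k = {z. stake k z \<in> {w. \<exists>y\<in>X \<inter> B. stake k y = w}}" for k
  have "B \<subseteq> X"
    using sets.sets_into_space[OF B] by (simp add: space_m)
  have "X \<inter> {z. stake k z \<in> W} \<in> sets m" for k W
    using cylinder_sets[of k W] by (simp add: Collect_conj_eq)
  then have sets: "X \<inter> inner k \<in> sets m" "X \<inter> outer k \<in> sets m" for k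
    unfolding inner_def outer_def by blast+
  have int_eq: "(\<Union>k. X \<inter> inner k) = word_topology A interior_of B"
    unfolding interior_of_word_topology inner_def by auto
  have cl_eq: "(\<Inter>k. X \<inter> outer k) = word_topology A closure_of B"
    unfolding closure_of_word_topology outer_def by auto
  have [measurable]: "word_topology A interior_of B \<in> sets m" "word_topology A closure_of B \<in> sets m"
    unfolding int_eq[symmetric] cl_eq[symmetric] using sets
    by (auto simp del: UN_simps INT_simps intro!: sets.countable_UN sets.countable_INT)
  have "word_topology A interior_of B \<subseteq> B" "B \<subseteq> word_topology A closure_of B"
    using \<open>B \<subseteq> X\<close> unfolding interior_of_word_topology closure_of_word_topology by auto
  moreover from this have "measure m (word_topology A closure_of B) =
      measure m (word_topology A interior_of B) + measure m (word_topology A frontier_of B)"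
    unfolding frontier_of_def by (subst finite_measure_Diff) auto
  ultimately have measures: "measure m (word_topology A interior_of B) = measure m B"
    "measure m (word_topology A closure_of B) = measure m B"
    using null B finite_measure_mono[of "word_topology A interior_of B" B]
      finite_measure_mono[of B "word_topology A closure_of B"] by auto
  have "inner k \<subseteq> inner l" "outer l \<subseteq> outer k" if "k \<le> l" for k l
    using stake_eq_mono[OF _ that] unfolding inner_def outer_def by auto
  then have mono: "incseq (\<lambda>k. X \<inter> inner k)" "decseq (\<lambda>k. X \<inter> outer k)"
    unfolding incseq_def decseq_def by blast+
  have lims: "(\<lambda>k. measure m (X \<inter> inner k)) \<longlonglongrightarrow> measure m B"
    "(\<lambda>k. measure m (X \<inter> outer k)) \<longlonglongrightarrow> measure m B"
    using finite_Lim_measure_incseq[OF _ mono(1)] finite_Lim_measure_decseq[OF _ mono(2)] sets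
    unfolding int_eq cl_eq measures by auto
  have mass_inner: "mass (inner k) T \<xi> \<le> mass B T \<xi>" and mass_outer: "mass B T \<xi> \<le> mass (outer k) T \<xi>" for k T
    using \<xi> \<open>B \<subseteq> X\<close> by (auto intro!: mass_mono simp: inner_def outer_def)
  show ?thesis
  proof (rule order_tendstoI)
    fix a assume "a < \<rho> \<xi> / drift * measure m B"
    then have "\<forall>\<^sub>F k in sequentially. a < \<rho> \<xi> / drift * measure m (X \<inter> inner k)"
      by (intro order_tendstoD(1)[OF tendsto_mult[OF tendsto_const lims(1)]])
    then obtain k where "a < \<rho> \<xi> / drift * measure m (X \<inter> inner k)"
      by (auto dest: eventually_happens)
    then have "\<forall>\<^sub>F T in at_top. a < mass (inner k) T \<xi> / T"
      using order_tendstoD(1)[OF mass_average_tendsto[OF \<xi> inner_def]] by blast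
    then show "\<forall>\<^sub>F T in at_top. a < mass B T \<xi> / T"
      using eventually_gt_at_top[of 0]
    proof eventually_elim
      case (elim T)
      then show ?case
        using divide_right_mono[OF mass_inner[of k T], of T] by linarith
    qed
  next
    fix a assume "\<rho> \<xi> / drift * measure m B < a"
    then have "\<forall>\<^sub>F k in sequentially. \<rho> \<xi> / drift * measure m (X \<inter> outer k) < a"
      by (intro order_tendstoD(2)[OF tendsto_mult[OF tendsto_const lims(2)]])
    then obtain k where "\<rho> \<xi> / drift * measure m (X \<inter> outer k) < a"
      by (auto dest: eventually_happens)
    then have "\<forall>\<^sub>F T in at_top. mass (outer k) T \<xi> / T < a"
      using order_tendstoD(2)[OF mass_average_tendsto[OF \<xi> outer_def]] by blast
    then show "\<forall>\<^sub>F T in at_top. mass B T \<xi> / T < a"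
      using eventually_gt_at_top[of 0]
    proof eventually_elim
      case (elim T)
      then show ?case
        using divide_right_mono[OF mass_outer[of T k], of T] by linarith
    qed
  qed
qed

definition counted :: "'e stream set \<Rightarrow> 'e stream \<Rightarrow> real \<Rightarrow> 'e list set" where
  "counted B \<xi> T = {w. w @- \<xi> \<in> X \<and> w @- \<xi> \<in> B \<and> S (length w) (w @- \<xi>) \<le> T}"

lemma orbit_count_eq: "orbit_count A \<psi> \<xi> B T = card (counted B \<xi> T)"
  unfolding orbit_count_def counted_def left_extensions_eq by simp

lemma counted_mono: "T \<le> T' \<Longrightarrow> counted B \<xi> T \<subseteq> counted B \<xi> T'"
  unfolding counted_def by auto

lemma nn_mass_eq_counted:
  "nn_mass B T \<xi> = (\<integral>\<^sup>+w. ennreal (exp (- S (length w) (w @- \<xi>))) * indicator (counted B \<xi> T) w \<partial>count_space UNIV)"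
  unfolding nn_mass_def orbit_sum_def word_sum_def counted_def
  by (intro nn_integral_cong) (auto simp: indicator_def)

text \<open>Each counted word contributes at least \<open>e\<^sup>-\<^sup>T\<close> to the finite mass.\<close>

lemma finite_counted:
  assumes "\<xi> \<in> X"
  shows "finite (counted B \<xi> T)"
proof (rule ccontr)
  assume "infinite (counted B \<xi> T)"
  then have "\<infinity> = ennreal (exp (- T)) * emeasure (count_space UNIV) (counted B \<xi> T)"
    by (simp add: ennreal_mult_top)
  also have "\<dots> = (\<integral>\<^sup>+w. ennreal (exp (- T)) * indicator (counted B \<xi> T) w \<partial>count_space UNIV)"
    by (simp add: nn_integral_cmult_indicator)
  also have "\<dots> \<le> nn_mass B T \<xi>"
    unfolding nn_mass_eq_counted
    by (intro nn_integral_mono) (auto simp: indicator_def counted_def ennreal_leI)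
  also have "\<dots> < \<infinity>"
    unfolding ennreal_mass[OF assms, symmetric] by simp
  finally show False by simp
qed

lemma mass_eq_sum_counted:
  assumes "\<xi> \<in> X"
  shows "mass B T \<xi> = (\<Sum>w\<in>counted B \<xi> T. exp (- S (length w) (w @- \<xi>)))"
proof -
  have "nn_mass B T \<xi> = (\<Sum>w\<in>counted B \<xi> T. ennreal (exp (- S (length w) (w @- \<xi>))))"
    unfolding nn_mass_eq_counted
    by (subst nn_integral_count_space'[OF finite_counted[OF assms, of B T]]) (auto intro!: sum.cong)
  then show ?thesis
    by (simp add: mass_def sum_nonneg)
qed

text \<open>A word is counted from its time \<open>S\<close> on, so it contributes the integral of \<open>e\<^sup>-\<^sup>t\<close> over \<open>[S, T]\<close>.\<close>

lemma integral_orbit_count: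
  assumes \<xi>: "\<xi> \<in> X" and "0 \<le> T"
  shows "integral {0..T} (\<lambda>t. real (orbit_count A \<psi> \<xi> B t) / exp t) =
    (\<Sum>w\<in>counted B \<xi> T. exp (- S (length w) (w @- \<xi>)) - exp (- T))"
proof (rule integral_unique)
  let ?s = "\<lambda>w. S (length w) (w @- \<xi>)"
  have "((\<lambda>t. if t \<in> {?s w..T} then exp (- t) else 0) has_integral (exp (- ?s w) - exp (- T))) {0..T}"
    if w: "w \<in> counted B \<xi> T" for w
  proof -
    have "0 \<le> ?s w" "?s w \<le> T"
      using w S_nonneg by (auto simp: counted_def)
    moreover have "((\<lambda>t. exp (- t)) has_integral (- exp (- T) - - exp (- ?s w))) {?s w..T}"
      using \<open>?s w \<le> T\<close>
      by (intro fundamental_theorem_of_calculus)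
        (auto intro!: derivative_eq_intros simp flip: has_real_derivative_iff_has_vector_derivative)
    ultimately show ?thesis
      by (subst has_integral_restrict) auto
  qed
  then have sum: "((\<lambda>t. \<Sum>w\<in>counted B \<xi> T. if t \<in> {?s w..T} then exp (- t) else 0) has_integral
      (\<Sum>w\<in>counted B \<xi> T. exp (- ?s w) - exp (- T))) {0..T}"
    by (intro has_integral_sum finite_counted \<xi>)
  have count: "real (orbit_count A \<psi> \<xi> B t) / exp t =
      (\<Sum>w\<in>counted B \<xi> T. if t \<in> {?s w..T} then exp (- t) else 0)" if t: "t \<in> {0..T}" for t
  proof -
    have "counted B \<xi> t = {w \<in> counted B \<xi> T. t \<in> {?s w..T}}"
      using t unfolding counted_def by auto
    then have "real (orbit_count A \<psi> \<xi> B t) / exp t = (\<Sum>w\<in>{w \<in> counted B \<xi> T. t \<in> {?s w..T}}. exp (- t))"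
      unfolding orbit_count_eq by (simp add: exp_minus field_simps)
    also have "\<dots> = (\<Sum>w\<in>counted B \<xi> T. if t \<in> {?s w..T} then exp (- t) else 0)"
      using finite_counted[OF \<xi>] by (rule sum.inter_filter)
    finally show ?thesis .
  qed
  show "((\<lambda>t. real (orbit_count A \<psi> \<xi> B t) / exp t) has_integral
      (\<Sum>w\<in>counted B \<xi> T. exp (- ?s w) - exp (- T))) {0..T}"
    using count by (intro has_integral_eq[OF _ sum]) simp
qed

lemma integral_orbit_count_le:
  assumes "\<xi> \<in> X" "0 \<le> T"
  shows "integral {0..T} (\<lambda>t. real (orbit_count A \<psi> \<xi> B t) / exp t) \<le> mass B T \<xi>"
  unfolding integral_orbit_count[OF assms] mass_eq_sum_counted[OF assms(1)] by (intro sum_mono) simp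

lemma integral_orbit_count_ge:
  assumes "\<xi> \<in> X" "0 \<le> T" "0 \<le> h"
  shows "(1 - exp (- h)) * mass B (T - h) \<xi> \<le> integral {0..T} (\<lambda>t. real (orbit_count A \<psi> \<xi> B t) / exp t)"
proof -
  let ?s = "\<lambda>w. S (length w) (w @- \<xi>)"
  have "(1 - exp (- h)) * mass B (T - h) \<xi> = (\<Sum>w\<in>counted B \<xi> (T - h). (1 - exp (- h)) * exp (- ?s w))"
    unfolding mass_eq_sum_counted[OF assms(1)] sum_distrib_left ..
  also have "\<dots> \<le> (\<Sum>w\<in>counted B \<xi> (T - h). exp (- ?s w) - exp (- T))"
  proof (rule sum_mono)
    fix w assume "w \<in> counted B \<xi> (T - h)"
    then have "exp (- T) \<le> exp (- h) * exp (- ?s w)"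
      unfolding exp_add[symmetric] counted_def by simp
    then show "(1 - exp (- h)) * exp (- ?s w) \<le> exp (- ?s w) - exp (- T)"
      by (simp add: left_diff_distrib)
  qed
  also have "\<dots> \<le> (\<Sum>w\<in>counted B \<xi> T. exp (- ?s w) - exp (- T))"
    using assms by (intro sum_mono2 finite_counted counted_mono) (auto simp: counted_def)
  finally show ?thesis
    unfolding integral_orbit_count[OF assms(1,2)] .
qed

text \<open>The integral lies between \<open>(1 - e\<^sup>-\<^sup>h) mass (T - h)\<close> and \<open>mass T\<close>. Any \<open>h\<close> that tends to infinity
  more slowly than \<open>T\<close> makes the two bounds agree to first order; the choice is the square root of \<open>T\<close>.\<close>

theorem cesaro_orbit_count_tendsto:
  assumes \<xi>: "\<xi> \<in> X" and "B \<in> sets m" and "measure m (word_topology A frontier_of B) = 0"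
  shows "((\<lambda>T. 1 / T * integral {0..T} (\<lambda>t. real (orbit_count A \<psi> \<xi> B t) / exp t)) \<longlongrightarrow>
    \<rho> \<xi> / drift * measure m B) at_top"
proof -
  let ?l = "\<rho> \<xi> / drift * measure m B"
  let ?I = "\<lambda>T. integral {0..T} (\<lambda>t. real (orbit_count A \<psi> \<xi> B t) / exp t)"
  have upper: "((\<lambda>T. mass B T \<xi> / T) \<longlongrightarrow> ?l) at_top"
    by (rule mass_average_tendsto_borel[OF assms])
  have "filterlim (\<lambda>T::real. T - sqrt T) at_top at_top"
    by real_asymp
  then have "((\<lambda>T. mass B (T - sqrt T) \<xi> / (T - sqrt T)) \<longlongrightarrow> ?l) at_top"
    by (rule filterlim_compose[OF upper])
  moreover have "((\<lambda>T::real. (1 - exp (- sqrt T)) * ((T - sqrt T) / T)) \<longlongrightarrow> 1) at_top"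
    by real_asymp
  ultimately have "((\<lambda>T. ((1 - exp (- sqrt T)) * ((T - sqrt T) / T)) *
      (mass B (T - sqrt T) \<xi> / (T - sqrt T))) \<longlongrightarrow> 1 * ?l) at_top"
    by (intro tendsto_mult)
  moreover have "\<forall>\<^sub>F T in at_top. ((1 - exp (- sqrt T)) * ((T - sqrt T) / T)) *
      (mass B (T - sqrt T) \<xi> / (T - sqrt T)) = (1 - exp (- sqrt T)) * mass B (T - sqrt T) \<xi> / T"
    using eventually_gt_at_top[of 1]
  proof eventually_elim
    case (elim T)
    then have "sqrt T < T"
      by (intro real_less_lsqrt) (auto simp: power2_eq_square)
    then show ?case by simp
  qed
  ultimately have lower: "((\<lambda>T. (1 - exp (- sqrt T)) * mass B (T - sqrt T) \<xi> / T) \<longlongrightarrow> ?l) at_top"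
    by (simp add: filterlim_cong[OF refl refl])
  show ?thesis
  proof (rule tendsto_sandwich[OF _ _ lower upper])
    show "\<forall>\<^sub>F T in at_top. (1 - exp (- sqrt T)) * mass B (T - sqrt T) \<xi> / T \<le> 1 / T * ?I T"
      using eventually_gt_at_top[of 0]
    proof eventually_elim
      case (elim T)
      then have "(1 - exp (- sqrt T)) * mass B (T - sqrt T) \<xi> / T \<le> ?I T / T"
        using \<xi> by (intro divide_right_mono integral_orbit_count_ge) auto
      then show ?case by simp
    qed
    show "\<forall>\<^sub>F T in at_top. 1 / T * ?I T \<le> mass B T \<xi> / T"
      using eventually_gt_at_top[of 0]
    proof eventually_elim
      case (elim T)
      then have "?I T / T \<le> mass B T \<xi> / T"
        using \<xi> by (intro divide_right_mono integral_orbit_count_le) auto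
      then show ?case by simp
    qed
  qed
qed

end

section \<open>Reduction of the hypotheses to the renewal setting\<close>

text \<open>Hoelder continuity in terms of common prefixes, with ratio \<open>2\<^bsup>-\<alpha>\<^esup>\<close>.\<close>

lemma holder_variation_bound:
  fixes f :: "'e stream \<Rightarrow> real"
  assumes "holder_variation \<alpha> V f \<le> h" "h < \<infinity>" "0 < \<alpha>"
    and "x \<in> V" "y \<in> V" "stake k x = stake k y"
  shows "\<bar>f x - f y\<bar> \<le> enn2real h * ((1 / 2) powr \<alpha>) ^ k"
proof (cases "x = y")
  case False
  let ?d = "word_dist x y"
  have d: "0 < ?d" using False by (simp add: word_dist_def)
  have "ennreal (\<bar>f x - f y\<bar> / ?d powr \<alpha>) \<le> holder_variation \<alpha> V f"
    unfolding holder_variation_def using assms False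
    by (intro SUP_upper2[of "(x, y)"]) auto
  also have "\<dots> \<le> ennreal (enn2real h)"
    using assms(1,2) by simp
  finally have "\<bar>f x - f y\<bar> / ?d powr \<alpha> \<le> enn2real h"
    by (simp add: ennreal_le_iff)
  then have "\<bar>f x - f y\<bar> \<le> enn2real h * ?d powr \<alpha>"
    using d by (simp add: pos_divide_le_eq)
  also have "\<dots> \<le> enn2real h * ((1 / 2) ^ k) powr \<alpha>"
    using d assms(3) word_dist_le_power[OF assms(6)]
    by (intro mult_left_mono powr_mono2) auto
  also have "((1 / 2) ^ k) powr \<alpha> = ((1 / 2 :: real) powr \<alpha>) ^ k"
    by (simp add: powr_powr mult.commute flip: powr_realpow)
  finally show ?thesis .
qed simp

text \<open>Real infinite sums have the value \<open>0\<close> when they do not converge. Summability of the potential excludes this,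
  and bounds the values of the operator so that they are integrable.\<close>

lemma summable_on_transfer:
  fixes g :: "'e stream \<Rightarrow> real"
  assumes summable: "summable_potential A \<psi>"
    and g: "\<And>x. x \<in> shift_space A \<Longrightarrow> 0 \<le> g x" "\<And>x. x \<in> shift_space A \<Longrightarrow> g x \<le> b"
  shows "(\<lambda>a. exp (\<psi> (a ## x)) * g (a ## x)) summable_on {a. a ## x \<in> shift_space A}"
    and "transfer_op A \<psi> g x \<le> enn2real (\<Sum>\<^sub>\<infinity>a\<in>UNIV. SUP \<xi>\<in>cylinder A [a]. ennreal \<bar>exp (\<psi> \<xi>)\<bar>) * max 0 b"
proof -
  define s where "s a = (SUP \<xi>\<in>cylinder A [a]. ennreal \<bar>exp (\<psi> \<xi>)\<bar>)" for a
  let ?I = "{a. a ## x \<in> shift_space A}"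
  let ?B = "enn2real (infsum s UNIV) * max 0 b"
  have fin: "infsum s UNIV < \<infinity>"
    using summable unfolding summable_potential_def s_def .
  have le: "(\<Sum>a\<in>F. exp (\<psi> (a ## x)) * g (a ## x)) \<le> ?B" if F: "finite F" "F \<subseteq> ?I" for F
  proof -
    have "ennreal (\<Sum>a\<in>F. exp (\<psi> (a ## x))) = (\<Sum>a\<in>F. ennreal (exp (\<psi> (a ## x))))"
      by (rule sum_ennreal[symmetric]) simp
    also have "\<dots> \<le> (\<Sum>a\<in>F. s a)"
    proof (rule sum_mono)
      fix a assume "a \<in> F"
      then have "a ## x \<in> cylinder A [a]" using F by (auto simp: cylinder_def)
      then show "ennreal (exp (\<psi> (a ## x))) \<le> s a"
        unfolding s_def by (rule SUP_upper2) simp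
    qed
    also have "\<dots> \<le> infsum s UNIV"
      using F(1) by (subst nonneg_infsum_complete) (auto intro: SUP_upper2)
    also have "\<dots> = ennreal (enn2real (infsum s UNIV))"
      using fin by simp
    finally have "(\<Sum>a\<in>F. exp (\<psi> (a ## x))) \<le> enn2real (infsum s UNIV)"
      by (simp add: ennreal_le_iff)
    then have "(\<Sum>a\<in>F. exp (\<psi> (a ## x))) * max 0 b \<le> ?B"
      by (rule mult_right_mono) simp
    moreover have "(\<Sum>a\<in>F. exp (\<psi> (a ## x)) * g (a ## x)) \<le> (\<Sum>a\<in>F. exp (\<psi> (a ## x))) * max 0 b"
      unfolding sum_distrib_right using F g(2) by (intro sum_mono mult_left_mono) (auto simp: max.coboundedI2)
    ultimately show ?thesis by linarith
  qed
  show summ: "(\<lambda>a. exp (\<psi> (a ## x)) * g (a ## x)) summable_on ?I"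
    using g(1) le by (intro nonneg_bdd_above_summable_on) (auto intro!: bdd_aboveI2[where M = ?B])
  show "transfer_op A \<psi> g x \<le> enn2real (\<Sum>\<^sub>\<infinity>a\<in>UNIV. SUP \<xi>\<in>cylinder A [a]. ennreal \<bar>exp (\<psi> \<xi>)\<bar>) * max 0 b"
    using infsum_le_finite_sums[OF summ le] unfolding transfer_op_def s_def by simp
qed

lemma nn_transfer_eq_transfer_op:
  fixes g :: "'e stream \<Rightarrow> real"
  assumes "summable_potential A \<psi>"
    and g: "\<And>x. x \<in> shift_space A \<Longrightarrow> 0 \<le> g x" "\<And>x. x \<in> shift_space A \<Longrightarrow> g x \<le> b"
  shows "nn_transfer A \<psi> (\<lambda>x. ennreal (g x)) x = ennreal (transfer_op A \<psi> g x)"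
proof -
  let ?I = "{a. a ## x \<in> shift_space A}" and ?f = "\<lambda>a. exp (\<psi> (a ## x)) * g (a ## x)"
  have nonneg: "0 \<le> ?f a" if "a \<in> ?I" for a
    using that g(1) by simp
  have "(\<lambda>a. norm (?f a)) summable_on ?I"
    using summable_on_transfer(1)[where g = g and b = b and x = x, OF assms] nonneg
    by (subst summable_on_cong[where g = ?f]) auto
  then have abs: "Infinite_Set_Sum.abs_summable_on ?f ?I"
    using abs_summable_equivalent by blast
  have "nn_transfer A \<psi> (\<lambda>x. ennreal (g x)) x = (\<integral>\<^sup>+a. ennreal (?f a) * indicator ?I a \<partial>count_space UNIV)"
    unfolding nn_transfer_def using g(1)
    by (intro nn_integral_cong) (auto simp: indicator_def ennreal_mult)
  also have "\<dots> = (\<integral>\<^sup>+a. ennreal (?f a) \<partial>count_space ?I)"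
    by (rule nn_integral_count_space_indicator[symmetric]) simp
  also have "\<dots> = ennreal (infsetsum ?f ?I)"
    by (rule nn_integral_conv_infsetsum[OF abs nonneg])
  also have "infsetsum ?f ?I = transfer_op A \<psi> g x"
    unfolding infsetsum_infsum[OF abs] transfer_op_def by simp
  finally show ?thesis .
qed

lemma transfer_op_nonneg:
  fixes g :: "'e stream \<Rightarrow> real"
  assumes "\<And>x. x \<in> shift_space A \<Longrightarrow> 0 \<le> g x"
  shows "0 \<le> transfer_op A \<psi> g x"
  unfolding transfer_op_def using assms by (intro infsum_nonneg) auto

lemma exists_preimage:
  assumes "finitely_primitive A" "x \<in> shift_space A"
  shows "\<exists>a. a ## x \<in> shift_space A"
proof -
  obtain \<tau> where "(stake 1 x @ \<tau>) @- x \<in> shift_space A"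
    using finitely_primitive_bridge[OF assms(1)] assms(2) by (metis zero_less_one)
  then obtain w where w: "w @- x \<in> shift_space A" "w \<noteq> []"
    by (metis append_is_Nil_conv stake_invert_Nil zero_neq_one)
  then obtain u a where "w = u @ [a]" by (metis rev_exhaust)
  then have "u @- (a ## x) \<in> shift_space A" using w(1) by simp
  then show ?thesis using shift_space_suffix by blast
qed

text \<open>The logarithm vanishes also at \<open>0\<close> and \<open>-1\<close>, so zero pressure alone is not enough. Positivity comes from a
  preimage of \<open>x\<close>, which contributes a positive term to \<open>L \<rho> x\<close>.\<close>

lemma leading_eigenvalue_eq_1:
  fixes \<rho> :: "'e stream \<Rightarrow> real"
  assumes "finitely_primitive A" "x \<in> shift_space A" "pressure A \<psi> = 0" "summable_potential A \<psi>"
    and \<rho>: "\<And>x. x \<in> shift_space A \<Longrightarrow> 0 < \<rho> x" "\<And>x. x \<in> shift_space A \<Longrightarrow> \<rho> x \<le> b"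
    and eigen: "transfer_op A \<psi> \<rho> x = leading_eigenvalue A \<psi> * \<rho> x"
  shows "leading_eigenvalue A \<psi> = 1"
proof -
  obtain a where a: "a ## x \<in> shift_space A" using exists_preimage[OF assms(1,2)] ..
  have "0 < ennreal (exp (\<psi> (a ## x))) * ennreal (\<rho> (a ## x))"
    using \<rho>(1)[OF a] by (simp add: ennreal_zero_less_mult_iff)
  also have "\<dots> \<le> nn_transfer A \<psi> (\<lambda>x. ennreal (\<rho> x)) x"
    unfolding nn_transfer_def using a nn_integral_ge_point[of a UNIV
        "\<lambda>a. indicator (shift_space A) (a ## x) * ennreal (exp (\<psi> (a ## x))) * ennreal (\<rho> (a ## x))"]
    by simp
  also have "\<dots> = ennreal (leading_eigenvalue A \<psi> * \<rho> x)"
    using nn_transfer_eq_transfer_op[OF assms(4), where g = \<rho> and b = b and x = x] \<rho> eigen by (simp add: less_imp_le)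
  finally have "0 < leading_eigenvalue A \<psi>"
    using \<rho>(1)[OF assms(2)] by (simp add: zero_less_mult_iff)
  then show ?thesis
    using assms(3) by (simp add: pressure_def)
qed

theorem theorem1p10:
  fixes A :: "'e::countable \<Rightarrow> 'e \<Rightarrow> bool"
    and \<psi> \<rho> :: "'e stream \<Rightarrow> real"
    and m :: "'e stream measure"
    and \<xi> :: "'e stream" and B :: "'e stream set"
  assumes "finitely_primitive A"
    and "normal_potential A \<psi>"
    and "eigenmeasure A \<psi> m"
    and "eigenfunction A \<psi> m \<rho>"
    and "integrable (equilibrium_state m \<rho>) (\<lambda>\<omega>. \<bar>\<psi> \<omega>\<bar>)"
    and "\<xi> \<in> shift_space A"
    and "B \<in> sets (word_borel A)"
    and "measure m (word_topology A frontier_of B) = 0"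
  shows "((\<lambda>T. 1 / T * integral {0..T} (\<lambda>t. real (orbit_count A \<psi> \<xi> B t) / exp t)) \<longlongrightarrow>
           \<rho> \<xi> / (\<integral>\<omega>. - \<psi> \<omega> \<partial>equilibrium_state m \<rho>) * measure m B) at_top"
proof -
  let ?X = "shift_space A"
  have summable: "summable_potential A \<psi>" and zero: "pressure A \<psi> = 0"
    and neg: "(SUP \<xi>\<in>?X. ereal (\<psi> \<xi>)) < 0"
    using assms(2) by (auto simp: normal_potential_def)
  obtain \<alpha> where \<alpha>: "0 < \<alpha>" "level1_holder A \<alpha> \<psi>"
    using assms(2) by (auto simp: normal_potential_def)
  obtain \<beta> where \<beta>: "0 < \<beta>" "\<rho> \<in> holder_space A \<beta>"
    using assms(4) by (auto simp: eigenfunction_def)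
  have rho_pos: "0 < \<rho> x" if "x \<in> ?X" for x
    using assms(4) that by (auto simp: eigenfunction_def)
  obtain R where R: "\<rho> x \<le> R" if "x \<in> ?X" for x
  proof -
    have "bounded (\<rho> ` ?X)" using \<beta>(2) by (simp add: holder_space_def)
    then obtain R where "\<forall>y\<in>\<rho> ` ?X. norm y \<le> R" by (auto simp: bounded_iff)
    then show thesis by (intro that[of R]) (auto dest: abs_le_D1)
  qed
  have "leading_eigenvalue A \<psi> = 1"
    using assms(4,6) rho_pos R
    by (intro leading_eigenvalue_eq_1[OF assms(1,6) zero summable, where \<rho> = \<rho> and b = R]) (auto simp: eigenfunction_def)
  then have fixed: "transfer_op A \<psi> \<rho> x = \<rho> x" if "x \<in> ?X" for x
    using assms(4) that by (simp add: eigenfunction_def)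
  have invariant: "(\<integral>\<omega>. transfer_op A \<psi> g \<omega> \<partial>m) = (\<integral>\<omega>. g \<omega> \<partial>m)"
    if "continuous_map (word_topology A) euclidean g" "bounded (g ` ?X)" for g :: "'e stream \<Rightarrow> real"
    using assms(3) that \<open>leading_eigenvalue A \<psi> = 1\<close> by (simp add: eigenmeasure_def)
  have prob: "prob_space m" and sets_m: "sets m = sets (word_borel A)"
    using assms(3) by (auto simp: eigenmeasure_def)
  obtain r where "(SUP \<xi>\<in>?X. ereal (\<psi> \<xi>)) < ereal r" "ereal r < 0"
    using ereal_dense2[OF neg] by auto
  then have r: "r < 0" "\<psi> x \<le> r" if "x \<in> ?X" for x
    using that SUP_upper[of x ?X "\<lambda>x. ereal (\<psi> x)"] by (auto simp: less_eq_ereal_def[symmetric])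
      (metis ereal_less_eq(3) less_imp_le order_trans)
  define H where "H = (SUP a. holder_variation \<alpha> (cylinder A [a]) \<psi>)"
  have H: "H < \<infinity>" using \<alpha>(2) by (simp add: H_def level1_holder_def)
  interpret prob_space m by (rule prob)
  interpret H: holder_shift A \<psi> m "enn2real H" "(1 / 2) powr \<alpha>"
  proof
    show "(1 / 2) powr \<alpha> < (1::real)"
      using powr_less_mono2[of \<alpha> "1 / 2" 1] \<alpha>(1) by simp
    show "\<bar>\<psi> x - \<psi> y\<bar> \<le> enn2real H * ((1 / 2) powr \<alpha>) ^ k"
      if "x \<in> ?X" "y \<in> ?X" "0 < k" "stake k x = stake k y" for x y k
    proof (rule holder_variation_bound[OF _ H \<alpha>(1) _ _ that(4)])
      show "holder_variation \<alpha> (cylinder A [x !! 0]) \<psi> \<le> H"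
        unfolding H_def by (rule SUP_upper) simp
      have "stake 1 x = stake 1 y"
        using that(3,4) by (intro stake_eq_mono[OF that(4)]) simp
      then show "x \<in> cylinder A [x !! 0]" "y \<in> cylinder A [x !! 0]"
        using that(1,2) by (auto simp: cylinder_def)
    qed
  qed (auto simp: sets_m)
  have rho_continuous: "\<exists>k. \<forall>y\<in>?X. stake k y = stake k x \<longrightarrow> \<bar>\<rho> y - \<rho> x\<bar> < e"
    if "x \<in> ?X" "0 < e" for x e
  proof -
    let ?h = "holder_variation \<beta> ?X \<rho>"
    have "(1 / 2) powr \<beta> < (1::real)"
      using powr_less_mono2[of \<beta> "1 / 2" 1] \<beta>(1) by simp
    then have "(\<lambda>k. enn2real ?h * ((1 / 2) powr \<beta>) ^ k) \<longlonglongrightarrow> enn2real ?h * 0"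
      by (intro tendsto_intros LIMSEQ_power_zero) simp
    then have "\<forall>\<^sub>F k in sequentially. enn2real ?h * ((1 / 2) powr \<beta>) ^ k < e"
      using \<open>0 < e\<close> by (intro order_tendstoD) auto
    then obtain k where k: "enn2real ?h * ((1 / 2) powr \<beta>) ^ k < e"
      by (auto dest: eventually_happens)
    have "?h < \<infinity>" using \<beta>(2) by (simp add: holder_space_def)
    then have "\<bar>\<rho> y - \<rho> x\<bar> < e" if "y \<in> ?X" "stake k y = stake k x" for y
      using holder_variation_bound[OF order_refl _ \<beta>(1) that(1) \<open>x \<in> ?X\<close> that(2), of \<rho>] k by linarith
    then show ?thesis by blast
  qed
  have rho_meas: "\<rho> \<in> borel_measurable m"
    unfolding H.borel_m using rho_continuous by (rule borel_measurable_if_continuous)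
  have rho_AE: "AE x in m. 0 \<le> \<rho> x"
    using rho_pos by (intro AE_I2) (auto simp: H.space_m less_imp_le)
  have invariant_cylinder: "(\<integral>\<^sup>+x. nn_transfer A \<psi> (indicator {x \<in> ?X. stake k x = w}) x \<partial>m) =
      emeasure m {x \<in> ?X. stake k x = w}" for k w
  proof -
    define g :: "'e stream \<Rightarrow> real" where "g = (\<lambda>x. if stake k x = w then 1 else 0)"
    have g01: "0 \<le> g x" "g x \<le> 1" for x by (auto simp: g_def)
    have C: "{x \<in> ?X. stake k x = w} \<in> sets m"
      using H.cylinder_sets[of k "{w}"] by simp
    have "nn_transfer A \<psi> (indicator {x \<in> ?X. stake k x = w}) x = nn_transfer A \<psi> (\<lambda>x. ennreal (g x)) x" for x
      unfolding nn_transfer_def by (intro nn_integral_cong) (auto simp: indicator_def g_def)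
    then have op: "nn_transfer A \<psi> (indicator {x \<in> ?X. stake k x = w}) x = ennreal (transfer_op A \<psi> g x)" for x
      using nn_transfer_eq_transfer_op[OF summable, where g = g and b = 1] g01 by simp
    have "nn_transfer A \<psi> (indicator {x \<in> ?X. stake k x = w}) \<in> borel_measurable m"
      using C by (intro H.nn_transfer_measurable) auto
    then have "(\<lambda>x. enn2real (nn_transfer A \<psi> (indicator {x \<in> ?X. stake k x = w}) x)) \<in> borel_measurable m"
      by measurable
    then have meas: "transfer_op A \<psi> g \<in> borel_measurable m"
      unfolding op by (simp add: transfer_op_nonneg g01)
    have "integrable m (transfer_op A \<psi> g)"
      using meas summable_on_transfer(2)[OF summable, where g = g and b = 1] transfer_op_nonneg[of A g \<psi>] g01
      by (intro integrable_const_bound[where B = "enn2real (\<Sum>\<^sub>\<infinity>a\<in>UNIV. SUP \<xi>\<in>cylinder A [a]. ennreal \<bar>exp (\<psi> \<xi>)\<bar>) * max 0 1"]) auto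
    then have "(\<integral>\<^sup>+x. nn_transfer A \<psi> (indicator {x \<in> ?X. stake k x = w}) x \<partial>m) =
        ennreal (\<integral>x. transfer_op A \<psi> g x \<partial>m)"
      unfolding op by (rule nn_integral_eq_integral) (simp add: transfer_op_nonneg g01)
    also have "(\<integral>x. transfer_op A \<psi> g x \<partial>m) = (\<integral>x. g x \<partial>m)"
    proof (rule invariant)
      show "continuous_map (word_topology A) euclidean g"
        by (rule continuous_map_if_locally_constant[of k]) (simp add: g_def)
      show "bounded (g ` ?X)"
        using g01 by (intro boundedI[of _ 1]) auto
    qed
    also have "(\<integral>x. g x \<partial>m) = (\<integral>x. indicator {x \<in> ?X. stake k x = w} x \<partial>m)"
      by (intro Bochner_Integration.integral_cong) (auto simp: g_def H.space_m)
    also have "\<dots> = measure m {x \<in> ?X. stake k x = w}"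
      using C by simp
    finally show ?thesis
      by (simp add: emeasure_eq_measure)
  qed
  have int_psi_rho: "integrable m (\<lambda>x. \<psi> x * \<rho> x)"
  proof -
    have "integrable m (\<lambda>x. \<rho> x *\<^sub>R \<bar>\<psi> x\<bar>)"
      using assms(5) H.psi_measurable rho_meas rho_AE
      unfolding equilibrium_state_def by (subst (asm) integrable_density) auto
    then show ?thesis
      by (rule Bochner_Integration.integrable_bound)
        (use H.psi_measurable rho_meas in \<open>auto simp: abs_mult\<close>)
  qed
  interpret renewal_shift A \<psi> m "enn2real H" "(1 / 2) powr \<alpha>" \<rho> "- r" R
    using r assms(6) rho_pos R rho_continuous invariant_cylinder int_psi_rho
      nn_transfer_eq_transfer_op[OF summable, where g = \<rho> and b = R]
    by unfold_locales (auto simp: assms(1) prob fixed less_imp_le)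
  have "(\<integral>\<omega>. - \<psi> \<omega> \<partial>equilibrium_state m \<rho>) = drift"
    unfolding equilibrium_state_def drift_def using rho_meas rho_AE H.psi_measurable
    by (subst integral_density) (auto simp: mult.commute)
  then show ?thesis
    using cesaro_orbit_count_tendsto[OF assms(6) _ assms(8)] assms(7) sets_m by simp
qed

end
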